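(* Satisfiability of a given GAF sentence $\varphi$ is decidable, even if $\varphi$ contains the equality predicate (but no non-constant function symbols).
   Context: A first-order sentence $\varphi$ is in standard form if $\varphi = \forall \vec{x}_1 \exists \vec{y}_1 \ldots \forall \vec{x}_n \exists \vec{y}_n.\,\psi$, where the $\vec{x}_i,\vec{y}_i$ are tuples of variables ($\vec{x}_1$ and $\vec{y}_n$ may be empty), $\psi$ is quantifier-free, in negation normal form and uses only $\wedge,\vee,\neg$, every variable bound in the prefix occurs in $\psi$, and no variable is bound twice. Let $\vec{x}:=\bigcup_i\vec{x}_i$, $\vec{y}:=\bigcup_i\vec{y}_i$, let $\mathrm{At}$ be the set of atoms of $\varphi$ (here possibly including equations), $\mathrm{vars}(S)$ the set of variables occurring in a set $S$ of atoms, and for $v\in\vec{x}\cup\vec{y}$ let $\mathrm{idx}(v):=k$ iff $v\in\vec{x}_k$ or $v\in\vec{y}_k$. Such a sentence (with constant symbols allowed but no non-constant function symbols) belongs to the generalized Ackermann fragment (GAF) iff $\mathrm{At}$ can be partitioned into sets $\mathrm{At}_0$ and $\mathrm{At}_x$, $x\in\vec{x}$, such that (a) $\mathrm{vars}(\mathrm{At}_0)\cap\vec{x}=\emptyset$; (b) for every $x\in\vec{x}$, $\mathrm{vars}(\mathrm{At}_x)\cap\vec{x}=\{x\}$; (c) for every $y\in\vec{y}$ occurring in some $\mathrm{At}_x$, exactly one of the following holds: (c.1) for every $\mathrm{At}_x$ in which $y$ occurs, $\mathrm{idx}(y)<\mathrm{idx}(x)$; or (c.2) there is exactly one $\mathrm{At}_x$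 in which $y$ occurs, $y$ does not occur in $\mathrm{At}_0$, and $\mathrm{idx}(y)\ge\mathrm{idx}(x)$. *)

theory Defs
  imports Main "HOL-Library.Nat_Bijection" "HOL-Library.Countable_Set"
begin

section \<open>First-order formulas with equality and constants, without other function symbols\<close>

datatype tm = Var nat | Const nat

text \<open>A predicate symbol is determined by its name together with its arity,
  i.e. the length of the argument list; arity 0 is allowed.\<close>

datatype atom = Pred nat "tm list" | Eq tm tm

datatype fm =
    Atom atom
  | Neg fm
  | Con fm fm
  | Dis fm fm
  | All nat fm
  | Ex nat fm

fun tm_vars :: "tm \<Rightarrow> nat set" where
  "tm_vars (Var v) = {v}"
| "tm_vars (Const c) = {}"

fun atom_vars :: "atom \<Rightarrow> nat set" where
  "atom_vars (Pred P ts) = (\<Union>t\<in>set ts. tm_vars t)"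
| "atom_vars (Eq s t) = tm_vars s \<union> tm_vars t"

definition vars :: "atom set \<Rightarrow> nat set" where
  "vars S = (\<Union>a\<in>S. atom_vars a)"

fun atoms :: "fm \<Rightarrow> atom set" where
  "atoms (Atom a) = {a}"
| "atoms (Neg p) = atoms p"
| "atoms (Con p q) = atoms p \<union> atoms q"
| "atoms (Dis p q) = atoms p \<union> atoms q"
| "atoms (All v p) = atoms p"
| "atoms (Ex v p) = atoms p"

section \<open>Semantics\<close>

record 'u struct =
  domain :: "'u set"
  cst :: "nat \<Rightarrow> 'u"
  prd :: "nat \<Rightarrow> 'u list \<Rightarrow> bool"

definition is_struct :: "'u struct \<Rightarrow> bool" where
  "is_struct M \<longleftrightarrow> domain M \<noteq> {} \<and> range (cst M) \<subseteq> domain M"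

fun tm_val :: "'u struct \<Rightarrow> (nat \<Rightarrow> 'u) \<Rightarrow> tm \<Rightarrow> 'u" where
  "tm_val M e (Var v) = e v"
| "tm_val M e (Const c) = cst M c"

fun atom_holds :: "'u struct \<Rightarrow> (nat \<Rightarrow> 'u) \<Rightarrow> atom \<Rightarrow> bool" where
  "atom_holds M e (Pred P ts) = prd M P (map (tm_val M e) ts)"
| "atom_holds M e (Eq s t) = (tm_val M e s = tm_val M e t)"

fun holds :: "'u struct \<Rightarrow> (nat \<Rightarrow> 'u) \<Rightarrow> fm \<Rightarrow> bool" where
  "holds M e (Atom a) = atom_holds M e a"
| "holds M e (Neg p) = (\<not> holds M e p)"
| "holds M e (Con p q) = (holds M e p \<and> holds M e q)"
| "holds M e (Dis p q) = (holds M e p \<or> holds M e q)"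
| "holds M e (All v p) = (\<forall>d\<in>domain M. holds M (e(v := d)) p)"
| "holds M e (Ex v p) = (\<exists>d\<in>domain M. holds M (e(v := d)) p)"

definition models :: "'u struct \<Rightarrow> fm \<Rightarrow> bool" where
  "models M p \<longleftrightarrow> (\<forall>e. range e \<subseteq> domain M \<longrightarrow> holds M e p)"

text \<open>HOL cannot quantify over all carrier types within a formula. The structures considered
  here have as domain an arbitrary nonempty, finite or infinite, set of natural numbers.
  This is no restriction: by the downward Loewenheim-Skolem theorem, proved below as
  \<open>satisfiable_if_model\<close>, a formula with a model over any type is satisfiable in this sense.\<close>

definition satisfiable :: "fm \<Rightarrow> bool" where
  "satisfiable p \<longleftrightarrow> (\<exists>M :: nat struct. is_struct M \<and> models M p)"

subsection \<open>The restriction to countable domains is harmless\<close>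

instance tm :: countable by countable_datatype
instance atom :: countable by countable_datatype
instance fm :: countable by countable_datatype

fun all_vars :: "fm \<Rightarrow> nat set" where
  "all_vars (Atom a) = atom_vars a"
| "all_vars (Neg p) = all_vars p"
| "all_vars (Con p q) = all_vars p \<union> all_vars q"
| "all_vars (Dis p q) = all_vars p \<union> all_vars q"
| "all_vars (All v p) = insert v (all_vars p)"
| "all_vars (Ex v p) = insert v (all_vars p)"

lemma finite_atom_vars: "finite (atom_vars a)"
proof -
  have "finite (tm_vars t)" for t by (cases t) auto
  then show ?thesis by (cases a) auto
qed

lemma finite_all_vars: "finite (all_vars p)"
  by (induction p) (auto simp: finite_atom_vars)

lemma tm_val_cong: "(\<And>v. v \<in> tm_vars t \<Longrightarrow> e v = e' v) \<Longrightarrow> tm_val M e t = tm_val M e' t"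
  by (cases t) auto

lemma atom_holds_cong:
  assumes "\<And>v. v \<in> atom_vars a \<Longrightarrow> e v = e' v"
  shows "atom_holds M e a = atom_holds M e' a"
proof (cases a)
  case (Pred P ts)
  have "map (tm_val M e) ts = map (tm_val M e') ts"
    using assms Pred by (intro map_cong refl tm_val_cong) auto
  then show ?thesis unfolding Pred atom_holds.simps by (rule arg_cong)
next
  case (Eq s t)
  have "tm_val M e s = tm_val M e' s" "tm_val M e t = tm_val M e' t"
    using assms Eq by (auto intro!: tm_val_cong)
  with Eq show ?thesis by simp
qed

lemma holds_cong:
  "(\<And>v. v \<in> all_vars p \<Longrightarrow> e v = e' v) \<Longrightarrow> holds M e p = holds M e' p"
proof (induction p arbitrary: e e')
  case (Atom a)
  show ?case using atom_holds_cong[OF Atom] by simp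
next
  case (Neg p)
  show ?case using Neg.IH[of e e'] Neg.prems by simp
next
  case (Con p q)
  show ?case using Con.IH(1)[of e e'] Con.IH(2)[of e e'] Con.prems by simp
next
  case (Dis p q)
  show ?case using Dis.IH(1)[of e e'] Dis.IH(2)[of e e'] Dis.prems by simp
next
  case (All v p)
  have "holds M (e(v := d)) p = holds M (e'(v := d)) p" for d
    using All.prems by (intro All.IH) auto
  then show ?case by simp
next
  case (Ex v p)
  have "holds M (e(v := d)) p = holds M (e'(v := d)) p" for d
    using Ex.prems by (intro Ex.IH) auto
  then show ?case by simp
qed

datatype skolem_tm = Sk_Const nat | Sk_App fm nat "skolem_tm list"
instance skolem_tm :: countable by countable_datatype

definition list_env :: "'u struct \<Rightarrow> 'u list \<Rightarrow> nat \<Rightarrow> 'u" where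
  "list_env M us i = (if i < length us then us ! i else cst M 0)"

definition skolem :: "'u struct \<Rightarrow> fm \<Rightarrow> nat \<Rightarrow> 'u list \<Rightarrow> 'u" where
  "skolem M p v us =
     (if \<exists>d\<in>domain M. holds M ((list_env M us)(v := d)) p
      then SOME d. d \<in> domain M \<and> holds M ((list_env M us)(v := d)) p else cst M 0)"

primrec skolem_val :: "'u struct \<Rightarrow> skolem_tm \<Rightarrow> 'u" where
  "skolem_val M (Sk_Const c) = cst M c"
| "skolem_val M (Sk_App p v ts) = skolem M p v (map (skolem_val M) ts)"

lemma skolem_val_in_dom:
  assumes "is_struct M"
  shows "skolem_val M t \<in> domain M"
proof (cases t)
  case (Sk_Const c)
  then show ?thesis using assms by (auto simp: is_struct_def)
next
  case (Sk_App p v ts)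
  have "skolem M p v us \<in> domain M" for us
  proof (cases "\<exists>d\<in>domain M. holds M ((list_env M us)(v := d)) p")
    case True
    then have "\<exists>d. d \<in> domain M \<and> holds M ((list_env M us)(v := d)) p" by blast
    from someI_ex[OF this] True show ?thesis by (simp add: skolem_def)
  next
    case False
    then show ?thesis using assms by (auto simp: skolem_def is_struct_def)
  qed
  then show ?thesis using Sk_App by simp
qed

lemma skolem_witness:
  assumes e: "range e \<subseteq> range (skolem_val M)"
    and ex: "\<exists>d\<in>domain M. holds M (e(v := d)) p"
  shows "\<exists>d\<in>range (skolem_val M). holds M (e(v := d)) p"
proof -
  obtain N where N: "\<And>x. x \<in> all_vars p \<Longrightarrow> x < N"
    using finite_all_vars[of p] by (meson finite_nat_set_iff_bounded)
  have "\<forall>i. \<exists>t. skolem_val M t = e i" using e by (metis rangeE range_subsetD)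
  then obtain s where s: "\<And>i. skolem_val M (s i) = e i" by metis
  define us where "us = map e [0..<N]"
  have agree: "holds M ((list_env M us)(v := d)) p = holds M (e(v := d)) p" for d
    by (rule holds_cong) (use N in \<open>auto simp: list_env_def us_def\<close>)
  have "\<exists>d. d \<in> domain M \<and> holds M ((list_env M us)(v := d)) p" using ex agree by blast
  from someI_ex[OF this] this have "holds M ((list_env M us)(v := skolem M p v us)) p"
    by (auto simp: skolem_def)
  then have "holds M (e(v := skolem M p v us)) p" using agree by simp
  moreover have "skolem M p v us = skolem_val M (Sk_App p v (map s [0..<N]))"
    by (simp add: us_def s comp_def)
  ultimately show ?thesis by (metis rangeI)
qed

theorem satisfiable_if_model:
  fixes M :: "'u struct"
  assumes M: "is_struct M" and mod: "models M p"
  shows "satisfiable p"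
proof -
  define S where "S = range (skolem_val M)"
  define h where "h = to_nat_on S"
  have SD: "S \<subseteq> domain M" using skolem_val_in_dom[OF M] by (auto simp: S_def)
  have "countable S" by (simp add: S_def)
  then have inj: "inj_on h S" by (simp add: h_def inj_on_to_nat_on)
  define g where "g = inv_into S h"
  have gh: "g (h x) = x" if "x \<in> S" for x using inj that by (simp add: g_def)
  have cS: "cst M c \<in> S" for c unfolding S_def by (metis rangeI skolem_val.simps(1))
  define N :: "nat struct" where
    "N = \<lparr>domain = h ` S, cst = h \<circ> cst M, prd = \<lambda>P us. prd M P (map g us)\<rparr>"
  have N: "is_struct N" using cS by (auto simp: is_struct_def N_def)
  have tvS: "tm_val M e t \<in> S" if "range e \<subseteq> S" for e t
    using that cS by (cases t) auto
  have tv: "tm_val N (h \<circ> e) t = h (tm_val M e t)" for e t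
    by (cases t) (auto simp: N_def)
  have main: "holds N (h \<circ> e) q = holds M e q" if "range e \<subseteq> S" for e q
    using that
  proof (induction q arbitrary: e)
    case (Atom a)
    show ?case
    proof (cases a)
      case (Pred P ts)
      have "map g (map (tm_val N (h \<circ> e)) ts) = map (tm_val M e) ts"
        using tvS[OF Atom] gh by (simp add: tv)
      moreover have "prd N P us = prd M P (map g us)" for us by (simp add: N_def)
      ultimately show ?thesis unfolding Pred holds.simps atom_holds.simps by (simp only:)
    next
      case (Eq s t)
      show ?thesis unfolding Eq holds.simps atom_holds.simps tv
        using inj_on_eq_iff[OF inj tvS[OF Atom] tvS[OF Atom]] .
    qed
  next
    case (All v q)
    have up: "h \<circ> e(v := d) = (h \<circ> e)(v := h d)" for d by auto
    have IH: "holds N ((h \<circ> e)(v := h d)) q = holds M (e(v := d)) q" if "d \<in> S" for d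
    proof -
      have "range (e(v := d)) \<subseteq> S" using All.prems that by auto
      from All.IH[OF this] show ?thesis unfolding up .
    qed
    have "holds N (h \<circ> e) (All v q) \<longleftrightarrow> (\<forall>d\<in>S. holds M (e(v := d)) q)"
      using IH by (simp add: N_def)
    also have "\<dots> \<longleftrightarrow> (\<forall>d\<in>domain M. holds M (e(v := d)) q)"
      using skolem_witness[of e M v "Neg q", folded S_def] All.prems SD
      by (simp only: holds.simps) blast
    finally show ?case by (simp only: holds.simps)
  next
    case (Ex v q)
    have up: "h \<circ> e(v := d) = (h \<circ> e)(v := h d)" for d by auto
    have IH: "holds N ((h \<circ> e)(v := h d)) q = holds M (e(v := d)) q" if "d \<in> S" for d
    proof -
      have "range (e(v := d)) \<subseteq> S" using Ex.prems that by auto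
      from Ex.IH[OF this] show ?thesis unfolding up .
    qed
    have "holds N (h \<circ> e) (Ex v q) \<longleftrightarrow> (\<exists>d\<in>S. holds M (e(v := d)) q)"
      using IH by (simp add: N_def)
    also have "\<dots> \<longleftrightarrow> (\<exists>d\<in>domain M. holds M (e(v := d)) q)"
      using skolem_witness[of e M v q, folded S_def] Ex.prems SD by blast
    finally show ?case by (simp only: holds.simps)
  qed auto
  have "models N p"
    unfolding models_def
  proof (intro allI impI)
    fix e :: "nat \<Rightarrow> nat" assume e: "range e \<subseteq> domain N"
    then have r: "range (g \<circ> e) \<subseteq> S" using gh by (fastforce simp: N_def)
    have "h \<circ> (g \<circ> e) = e"
    proof
      fix i
      have "e i \<in> h ` S" using e by (auto simp: N_def)
      then show "(h \<circ> (g \<circ> e)) i = e i" using gh by auto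
    qed
    moreover have "holds M (g \<circ> e) p" using mod r SD by (simp add: models_def)
    ultimately show "holds N e p" using main[OF r, of p] by simp
  qed
  with N show ?thesis unfolding satisfiable_def by blast
qed

section \<open>Standard form\<close>

text \<open>A quantifier prefix is a list of blocks; the pair \<open>(xs, ys)\<close> stands for
  \<open>\<forall>xs. \<exists>ys.\<close>\<close>

type_synonym prefix = "(nat list \<times> nat list) list"

fun close :: "prefix \<Rightarrow> fm \<Rightarrow> fm" where
  "close [] p = p"
| "close ((xs, ys) # bs) p = foldr All xs (foldr Ex ys (close bs p))"

definition univ_vars :: "prefix \<Rightarrow> nat set" where
  "univ_vars bs = (\<Union>(xs, ys)\<in>set bs. set xs)"

definition ex_vars :: "prefix \<Rightarrow> nat set" where
  "ex_vars bs = (\<Union>(xs, ys)\<in>set bs. set ys)"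

text \<open>Blocks are numbered from 0; only comparisons between indices matter.\<close>

definition idx :: "prefix \<Rightarrow> nat \<Rightarrow> nat" where
  "idx bs v = (THE k. k < length bs \<and> (v \<in> set (fst (bs ! k)) \<or> v \<in> set (snd (bs ! k))))"

fun nnf :: "fm \<Rightarrow> bool" where
  "nnf (Atom a) = True"
| "nnf (Neg p) = (\<exists>a. p = Atom a)"
| "nnf (Con p q) = (nnf p \<and> nnf q)"
| "nnf (Dis p q) = (nnf p \<and> nnf q)"
| "nnf (All v p) = nnf p"
| "nnf (Ex v p) = nnf p"

fun qfree :: "fm \<Rightarrow> bool" where
  "qfree (Atom a) = True"
| "qfree (Neg p) = qfree p"
| "qfree (Con p q) = (qfree p \<and> qfree q)"
| "qfree (Dis p q) = (qfree p \<and> qfree q)"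
| "qfree (All v p) = False"
| "qfree (Ex v p) = False"

text \<open>Only the first universal and the last existential tuple may be empty.
  The last conjunct says both that every bound variable occurs in the matrix and that the
  formula is closed.\<close>

definition standard_form :: "fm \<Rightarrow> prefix \<Rightarrow> fm \<Rightarrow> bool" where
  "standard_form p bs m \<longleftrightarrow>
     p = close bs m \<and> bs \<noteq> [] \<and>
     (\<forall>k < length bs. (k \<noteq> 0 \<longrightarrow> fst (bs ! k) \<noteq> []) \<and>
                      (Suc k \<noteq> length bs \<longrightarrow> snd (bs ! k) \<noteq> [])) \<and>
     qfree m \<and> nnf m \<and>
     distinct (concat (map (\<lambda>(xs, ys). xs @ ys) bs)) \<and>
     vars (atoms m) = univ_vars bs \<union> ex_vars bs"

section \<open>The generalized Ackermann fragment\<close>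

definition gaf_partition :: "prefix \<Rightarrow> atom set \<Rightarrow> atom set \<Rightarrow> (nat \<Rightarrow> atom set) \<Rightarrow> bool" where
  "gaf_partition bs At At0 Atx \<longleftrightarrow>
     At = At0 \<union> (\<Union>x\<in>univ_vars bs. Atx x) \<and>
     (\<forall>x\<in>univ_vars bs. At0 \<inter> Atx x = {}) \<and>
     (\<forall>x\<in>univ_vars bs. \<forall>x'\<in>univ_vars bs. x \<noteq> x' \<longrightarrow> Atx x \<inter> Atx x' = {}) \<and>
     vars At0 \<inter> univ_vars bs = {} \<and>
     (\<forall>x\<in>univ_vars bs. vars (Atx x) \<inter> univ_vars bs = {x}) \<and>
     (\<forall>y\<in>ex_vars bs. (\<exists>x\<in>univ_vars bs. y \<in> vars (Atx x)) \<longrightarrow>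
        (let c1 = (\<forall>x\<in>univ_vars bs. y \<in> vars (Atx x) \<longrightarrow> idx bs y < idx bs x);
             c2 = (\<exists>x\<in>univ_vars bs. y \<in> vars (Atx x) \<and>
                     (\<forall>x'\<in>univ_vars bs. y \<in> vars (Atx x') \<longrightarrow> x' = x) \<and>
                     y \<notin> vars At0 \<and> idx bs y \<ge> idx bs x)
         in (c1 \<or> c2) \<and> \<not> (c1 \<and> c2)))"

definition gaf :: "fm \<Rightarrow> bool" where
  "gaf p \<longleftrightarrow>
     (\<exists>bs m At0 Atx. standard_form p bs m \<and> gaf_partition bs (atoms p) At0 Atx)"

section \<open>Decidability\<close>

text \<open>The (total) recursive functions: \<open>recursive k f\<close> says that the restriction of \<open>f\<close> to
  lists of length \<open>k\<close> is a \<open>k\<close>-ary general recursive function, minimization being applied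
  to regular functions only.\<close>

inductive recursive :: "nat \<Rightarrow> (nat list \<Rightarrow> nat) \<Rightarrow> bool" where
  zero: "recursive k (\<lambda>xs. 0)"
| succ: "recursive 1 (\<lambda>xs. Suc (xs ! 0))"
| proj: "i < k \<Longrightarrow> recursive k (\<lambda>xs. xs ! i)"
| comp: "recursive (length gs) f \<Longrightarrow> (\<forall>g\<in>set gs. recursive k g) \<Longrightarrow>
     recursive k (\<lambda>xs. f (map (\<lambda>g. g xs) gs))"
| prec: "recursive k f \<Longrightarrow> recursive (Suc (Suc k)) g \<Longrightarrow>
     recursive (Suc k) (\<lambda>xs. rec_nat (f (tl xs)) (\<lambda>n r. g (n # r # tl xs)) (hd xs))"
| mini: "recursive (Suc k) f \<Longrightarrow> (\<forall>xs. length xs = k \<longrightarrow> (\<exists>z. f (z # xs) = 0)) \<Longrightarrow>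
     recursive k (\<lambda>xs. LEAST z. f (z # xs) = 0)"
| ext: "recursive k f \<Longrightarrow> (\<forall>xs. length xs = k \<longrightarrow> f xs = g xs) \<Longrightarrow> recursive k g"

fun tm_encode :: "tm \<Rightarrow> nat" where
  "tm_encode (Var v) = prod_encode (0, v)"
| "tm_encode (Const c) = prod_encode (1, c)"

fun atom_encode :: "atom \<Rightarrow> nat" where
  "atom_encode (Pred P ts) =
     prod_encode (0, prod_encode (P, list_encode (map tm_encode ts)))"
| "atom_encode (Eq s t) = prod_encode (1, prod_encode (tm_encode s, tm_encode t))"

fun fm_encode :: "fm \<Rightarrow> nat" where
  "fm_encode (Atom a) = prod_encode (0, atom_encode a)"
| "fm_encode (Neg p) = prod_encode (1, fm_encode p)"
| "fm_encode (Con p q) = prod_encode (2, prod_encode (fm_encode p, fm_encode q))"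
| "fm_encode (Dis p q) = prod_encode (3, prod_encode (fm_encode p, fm_encode q))"
| "fm_encode (All v p) = prod_encode (4, prod_encode (v, fm_encode p))"
| "fm_encode (Ex v p) = prod_encode (5, prod_encode (v, fm_encode p))"

lemma inj_tm_encode: "inj tm_encode"
proof (rule injI)
  fix s t show "tm_encode s = tm_encode t \<Longrightarrow> s = t" by (cases s; cases t) auto
qed

lemma inj_atom_encode: "inj atom_encode"
proof (rule injI)
  fix a b show "atom_encode a = atom_encode b \<Longrightarrow> a = b"
    by (cases a; cases b)
      (auto simp: list_encode_eq inj_map_eq_map[OF inj_tm_encode] inj_eq[OF inj_tm_encode])
qed

lemma inj_fm_encode: "inj fm_encode"
proof (rule injI)
  fix p q show "fm_encode p = fm_encode q \<Longrightarrow> p = q"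
  proof (induction p arbitrary: q)
    case (Atom a)
    then show ?case using inj_atom_encode by (cases q) (auto dest: injD)
  next
    case (Neg p)
    then show ?case by (cases q) auto
  next
    case (Con p1 p2)
    then show ?case by (cases q) auto
  next
    case (Dis p1 p2)
    then show ?case by (cases q) auto
  next
    case (All v p)
    then show ?case by (cases q) auto
  next
    case (Ex v p)
    then show ?case by (cases q) auto
  qed
qed

text \<open>\<open>decidable_for C Q\<close>: some algorithm, given any formula from the class \<open>C\<close>, decides
  whether it has the property \<open>Q\<close>.\<close>

definition decidable_for :: "(fm \<Rightarrow> bool) \<Rightarrow> (fm \<Rightarrow> bool) \<Rightarrow> bool" where
  "decidable_for C Q \<longleftrightarrow>
     (\<exists>f. recursive 1 f \<and> (\<forall>p. C p \<longrightarrow> f [fm_encode p] = (if Q p then 1 else 0)))"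

end

theory Submission imports Defs begin

text \<open>GAF sentences have the finite model property with a computable bound, so satisfiability is
  decided by searching for a model of bounded size.

  Read the prefix as a game.  Existential variables are global, condition (c.1), or local to a
  single universal variable \<open>x\<close>, condition (c.2).  Once \<open>x\<close> is chosen, the rest of the play is
  affected only by the tree of choices for the variables local to \<open>x\<close>, and there are finitely many
  such trees; hence the existential player can win taking all global values from a finite set \<open>K\<close>.
  With \<open>K\<close> fixed the situation is that of the Ackermann class: pick one representative for every
  one-element type over \<open>K\<close> and finitely many witnesses for the representatives, and arrange copies
  of the witnesses on three cyclically ordered levels, the witnesses of an element being placed on the
  next level.  Equality causes no trouble because only elements of \<open>K\<close> are shared between witness
  tuples of different representatives.

  The search is expressed with bounded quantifiers only: a model of size \<open>n\<close> is given by the values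
  of the constants and a table of the truth values of all subformulas under all assignments, both
  coded by the digits of a number.\<close>

section \<open>Recursive functions and decidable predicates\<close>

text \<open>The obstacle is that a global variable may follow universal ones, so its value may
  depend on infinitely many moves. By (c.1) it occurs in no atom of a universal variable chosen
  before it, so its choice leaves their trees as they are. Positions with equal global values and
  equal trees therefore admit one common plan, and one universal move per tree has to be considered.

  An atom contains at most one universal variable \<open>x\<close>; its other variables are local to
  \<open>x\<close> or take values in \<open>K\<close>. So the copy must be faithful only on tuples
  made of \<open>K\<close>, one element and its witnesses. For equality it is enough that each such
  cluster is placed injectively.

  The code \<open>q\<close> of the sentence bounds the length of the prefix, the arities, the names
  of predicates and constants and the codes of the atoms; a size bound in terms of \<open>q\<close>
  alone is thus available and computable. The table has an entry for each pair of a formula code and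
  an assignment, which turns the truth definition into conditions between entries: no recursion over
  formula codes has to be shown computable.\<close>

definition env :: "nat list \<Rightarrow> nat \<Rightarrow> nat" where
  "env xs i = (if i < length xs then xs ! i else 0)"

text \<open>Environments free the closure rules below from arities and argument positions.
  Recursiveness is asked for all large \<open>k\<close>, not for one, so that thresholds can be
  added and binders can lengthen the argument list.\<close>

definition cmp :: "((nat \<Rightarrow> nat) \<Rightarrow> nat) \<Rightarrow> bool" where
  "cmp F \<longleftrightarrow> (\<exists>N. \<forall>k\<ge>N. recursive k (\<lambda>xs. F (env xs)))"

definition dec :: "((nat \<Rightarrow> nat) \<Rightarrow> bool) \<Rightarrow> bool" where
  "dec P \<longleftrightarrow> cmp (\<lambda>r. if P r then 1 else 0)"

lemma cmp_var: "cmp (\<lambda>r. r i)"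
  unfolding cmp_def
proof (intro exI[of _ "Suc i"] allI impI)
  fix k assume "Suc i \<le> k"
  then show "recursive k (\<lambda>xs. env xs i)"
    by (intro recursive.ext[OF recursive.proj[of i k]]) (auto simp: env_def)
qed

lemma recursive_const: "recursive k (\<lambda>xs. c)"
proof (induction c)
  case 0
  show ?case by (rule recursive.zero)
next
  case (Suc c)
  have "recursive k (\<lambda>xs. (\<lambda>xs. Suc (xs ! 0)) (map (\<lambda>g. g xs) [\<lambda>xs. c]))"
    by (rule recursive.comp) (use Suc recursive.succ in auto)
  then show ?case by simp
qed

lemma cmp_const: "cmp (\<lambda>r. c)"
  unfolding cmp_def using recursive_const by blast

lemma cmp_comp1:
  assumes f: "recursive 1 (\<lambda>xs. f (xs ! 0))" and g: "cmp G"
  shows "cmp (\<lambda>r. f (G r))"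
proof -
  obtain N where N: "\<And>k. k \<ge> N \<Longrightarrow> recursive k (\<lambda>xs. G (env xs))"
    using g by (auto simp: cmp_def)
  have "recursive k (\<lambda>xs. f (G (env xs)))" if "k \<ge> N" for k
  proof -
    have "recursive k (\<lambda>xs. (\<lambda>xs. f (xs ! 0)) (map (\<lambda>g. g xs) [\<lambda>xs. G (env xs)]))"
      by (rule recursive.comp) (use f N[OF that] in auto)
    then show ?thesis by simp
  qed
  then show ?thesis by (auto simp: cmp_def)
qed

lemma cmp_Suc: "cmp F \<Longrightarrow> cmp (\<lambda>r. Suc (F r))"
  by (rule cmp_comp1[OF recursive.succ])

lemma env_Cons: "env (x # xs) = case_nat x (env xs)"
  by (rule HOL.ext) (auto simp: env_def split: nat.split)

text \<open>A bound variable is pushed onto the front of the environment, so the variables of the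
  context are found one place further on.\<close>

lemma cmp_rec:
  assumes "cmp F" "cmp (\<lambda>r. S (r 0) (r 1) (\<lambda>i. r (Suc (Suc i))))" "cmp T"
  shows "cmp (\<lambda>r. rec_nat (F r) (\<lambda>n v. S n v r) (T r))"
proof -
  obtain N1 where N1: "\<And>k. k \<ge> N1 \<Longrightarrow> recursive k (\<lambda>xs. F (env xs))"
    using assms(1) by (auto simp: cmp_def)
  obtain N2 where N2: "\<And>k. k \<ge> N2 \<Longrightarrow>
      recursive k (\<lambda>xs. S (env xs 0) (env xs 1) (\<lambda>i. env xs (Suc (Suc i))))"
    using assms(2) by (auto simp: cmp_def)
  obtain N3 where N3: "\<And>k. k \<ge> N3 \<Longrightarrow> recursive k (\<lambda>xs. T (env xs))"
    using assms(3) by (auto simp: cmp_def)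
  have "recursive k (\<lambda>xs. rec_nat (F (env xs)) (\<lambda>n v. S n v (env xs)) (T (env xs)))"
    if k: "k \<ge> N1 + N2 + N3" for k
  proof -
    define h where "h = (\<lambda>ys. rec_nat (F (env (tl ys)))
      (\<lambda>n v. (\<lambda>xs. S (env xs 0) (env xs 1) (\<lambda>i. env xs (Suc (Suc i)))) (n # v # tl ys)) (hd ys))"
    have h: "recursive (Suc k) h"
      unfolding h_def by (rule recursive.prec) (use k in \<open>auto intro!: N1 N2[simplified]\<close>)
    define gs where "gs = (\<lambda>xs. T (env xs)) # map (\<lambda>i xs. xs ! i) [0..<k]"
    have "recursive k (\<lambda>xs. h (map (\<lambda>g. g xs) gs))"
    proof (rule recursive.comp)
      show "recursive (length gs) h" using h by (simp add: gs_def)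
      show "\<forall>g\<in>set gs. recursive k g"
        using k by (auto simp: gs_def intro!: N3 recursive.proj)
    qed
    then show ?thesis
    proof (rule recursive.ext, intro allI impI)
      fix xs :: "nat list" assume "length xs = k"
      then have "map (\<lambda>g. g xs) gs = T (env xs) # xs"
        by (auto simp: gs_def intro: nth_equalityI)
      then show "h (map (\<lambda>g. g xs) gs)
          = rec_nat (F (env xs)) (\<lambda>n v. S n v (env xs)) (T (env xs))"
        by (simp add: h_def env_Cons)
    qed
  qed
  then show ?thesis by (auto simp: cmp_def)
qed

lemma cmp_Least:
  assumes P: "dec (\<lambda>r. P (r 0) (\<lambda>i. r (Suc i)))" and ex: "\<And>r. \<exists>z. P z r"
  shows "cmp (\<lambda>r. LEAST z. P z r)"
proof -
  \<comment> \<open>\<open>mini\<close> looks for a zero, so the truth value has to be negated;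
    recursion on it does this before a conditional is available.\<close>
  have "cmp (\<lambda>r. rec_nat 1 (\<lambda>n v. 0) (if P (r 0) (\<lambda>i. r (Suc i)) then 1 else 0))"
    using P unfolding dec_def by (intro cmp_rec cmp_const)
  moreover have "rec_nat 1 (\<lambda>n v. 0) (if b then 1 else 0) = (if b then 0 else (1::nat))" for b
    by simp
  ultimately have "cmp (\<lambda>r. if P (r 0) (\<lambda>i. r (Suc i)) then 0 else 1)"
    by (simp only:)
  then obtain N where N: "\<And>k. k \<ge> N \<Longrightarrow>
      recursive k (\<lambda>xs. if P (env xs 0) (\<lambda>i. env xs (Suc i)) then 0 else 1)"
    by (auto simp: cmp_def)
  have "recursive k (\<lambda>xs. LEAST z. P z (env xs))" if "k \<ge> N" for k
  proof -
    have "recursive k (\<lambda>xs. LEAST z.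
        (\<lambda>xs. if P (env xs 0) (\<lambda>i. env xs (Suc i)) then 0 else (1::nat)) (z # xs) = 0)"
      by (rule recursive.mini[OF N]) (use that ex in \<open>auto simp: env_Cons\<close>)
    moreover have "(if b then 0 else (1::nat)) = 0 \<longleftrightarrow> b" for b by simp
    ultimately show ?thesis by (simp only: env_Cons nat.case)
  qed
  then show ?thesis by (auto simp: cmp_def)
qed

text \<open>The threshold of \<open>F\<close> may exceed 1. Further arguments 0 reach it, and the
  default 0 of \<open>env\<close> makes them invisible.\<close>

lemma cmp_imp_recursive:
  assumes "cmp F"
  shows "recursive 1 (\<lambda>xs. F (env [xs ! 0]))"
proof -
  obtain N where N: "\<And>k. k \<ge> N \<Longrightarrow> recursive k (\<lambda>xs. F (env xs))"
    using assms by (auto simp: cmp_def)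
  define gs :: "(nat list \<Rightarrow> nat) list" where "gs = (\<lambda>xs. xs ! 0) # replicate N (\<lambda>xs. 0)"
  have "recursive 1 (\<lambda>xs. (\<lambda>xs. F (env xs)) (map (\<lambda>g. g xs) gs))"
    by (rule recursive.comp) (auto simp: gs_def intro!: N recursive.zero recursive.proj)
  moreover have "env (map (\<lambda>g. g xs) gs) = env [xs ! 0]" for xs
    by (rule HOL.ext) (auto simp: gs_def env_def nth_Cons split: nat.split)
  ultimately show ?thesis by simp
qed

text \<open>Inserts a dummy variable at position \<open>j\<close>. Bodies under a binder use it to
  skip the bound variable; the loop in \<open>dec_ball_less\<close> uses it at position 1, where the
  accumulator sits between the counter and the context.\<close>

lemma cmp_weaken:
  assumes "cmp F"
  shows "cmp (\<lambda>r. F (\<lambda>i. r (if i < j then i else Suc i)))"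
proof -
  obtain N where N: "\<And>k. k \<ge> N \<Longrightarrow> recursive k (\<lambda>xs. F (env xs))"
    using assms by (auto simp: cmp_def)
  have "recursive k (\<lambda>xs. F (\<lambda>i. env xs (if i < j then i else Suc i)))" if "k \<ge> Suc (N + j)" for k
  proof -
    define gs :: "(nat list \<Rightarrow> nat) list" where
      "gs = map (\<lambda>i xs. xs ! (if i < j then i else Suc i)) [0..<k - 1]"
    have "recursive k (\<lambda>xs. (\<lambda>xs. F (env xs)) (map (\<lambda>g. g xs) gs))"
      by (rule recursive.comp) (use that in \<open>auto simp: gs_def intro!: N recursive.proj\<close>)
    then show ?thesis
    proof (rule recursive.ext, intro allI impI)
      fix xs :: "nat list" assume "length xs = k"
      then have "env (map (\<lambda>g. g xs) gs) = (\<lambda>i. env xs (if i < j then i else Suc i))"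
        using that by (intro HOL.ext) (auto simp: gs_def env_def)
      then show "F (env (map (\<lambda>g. g xs) gs)) = F (\<lambda>i. env xs (if i < j then i else Suc i))"
        by simp
    qed
  qed
  then show ?thesis unfolding cmp_def by blast
qed

lemma cmp_shift: "cmp F \<Longrightarrow> cmp (\<lambda>r. F (\<lambda>i. r (Suc i)))"
  using cmp_weaken[of F 0] by simp

lemma cmp_if:
  assumes P: "dec P" and F: "cmp F" and G: "cmp G"
  shows "cmp (\<lambda>r. if P r then F r else G r)"
proof -
  \<comment> \<open>Recursion with 0 or 1 steps is a conditional; \<open>F\<close> is shifted past
    the counter and the accumulator.\<close>
  have "cmp (\<lambda>r. rec_nat (G r) (\<lambda>n v. F r) (if P r then 1 else 0))"
    by (rule cmp_rec[OF G cmp_shift[OF cmp_shift[OF F]] P[unfolded dec_def]])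
  moreover have "rec_nat a (\<lambda>n v. b) (if c then 1 else 0) = (if c then b else a)"
    for a b :: nat and c by simp
  ultimately show ?thesis by (simp only:)
qed

lemma cmp_add: assumes "cmp F" "cmp G" shows "cmp (\<lambda>r. F r + G r)"
proof -
  have "cmp (\<lambda>r. rec_nat (F r) (\<lambda>n v. Suc v) (G r))"
    by (intro cmp_rec cmp_Suc cmp_var assms)
  moreover have "rec_nat a (\<lambda>n v. Suc v) b = a + b" for a b by (induction b) auto
  ultimately show ?thesis by simp
qed

lemma cmp_mult: assumes "cmp F" "cmp G" shows "cmp (\<lambda>r. F r * G r)"
proof -
  have "cmp (\<lambda>r. rec_nat 0 (\<lambda>n v. F r + v) (G r))"
    by (intro cmp_rec cmp_add cmp_const cmp_var assms assms(1)[THEN cmp_shift, THEN cmp_shift])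
  moreover have "rec_nat 0 (\<lambda>n v. a + v) b = a * b" for a b :: nat by (induction b) auto
  ultimately show ?thesis by simp
qed

lemma cmp_power: assumes "cmp F" "cmp G" shows "cmp (\<lambda>r. F r ^ G r)"
proof -
  have "cmp (\<lambda>r. rec_nat 1 (\<lambda>n v. F r * v) (G r))"
    by (intro cmp_rec cmp_mult cmp_const cmp_var assms assms(1)[THEN cmp_shift, THEN cmp_shift])
  moreover have "rec_nat 1 (\<lambda>n v. a * v) b = a ^ b" for a b :: nat by (induction b) auto
  ultimately show ?thesis by simp
qed

lemma cmp_diff: assumes "cmp F" "cmp G" shows "cmp (\<lambda>r. F r - G r)"
proof -
  have pred: "rec_nat 0 (\<lambda>n v. n) a = a - 1" for a by (cases a) auto
  have "cmp (\<lambda>r. rec_nat (F r) (\<lambda>n v. rec_nat 0 (\<lambda>n v. n) v) (G r))"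
    by (intro cmp_rec cmp_const cmp_var assms)
  moreover have "rec_nat a (\<lambda>n v. rec_nat 0 (\<lambda>n v. n) v) b = a - b" for a b
    by (induction b) (auto simp: pred)
  ultimately show ?thesis by simp
qed

lemma dec_not: assumes "dec P" shows "dec (\<lambda>r. \<not> P r)"
proof -
  have "cmp (\<lambda>r. if P r then 0 else 1)" by (intro cmp_if assms cmp_const)
  moreover have "(if b then 0 else 1) = (if \<not> b then 1 else (0::nat))" for b by simp
  ultimately show ?thesis unfolding dec_def by (simp only:)
qed

lemma dec_conj: assumes "dec P" "dec Q" shows "dec (\<lambda>r. P r \<and> Q r)"
proof -
  have "cmp (\<lambda>r. if P r then if Q r then 1 else 0 else 0)" by (intro cmp_if assms cmp_const)
  moreover have "(if a then if b then 1 else 0 else 0) = (if a \<and> b then 1 else (0::nat))" for a b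
    by simp
  ultimately show ?thesis unfolding dec_def by (simp only:)
qed

lemma dec_disj: "dec P \<Longrightarrow> dec Q \<Longrightarrow> dec (\<lambda>r. P r \<or> Q r)"
  using dec_not[OF dec_conj[OF dec_not dec_not]] by simp

lemma dec_imp: "dec P \<Longrightarrow> dec Q \<Longrightarrow> dec (\<lambda>r. P r \<longrightarrow> Q r)"
  using dec_not[OF dec_conj[OF _ dec_not]] by simp

lemma dec_iff: "dec P \<Longrightarrow> dec Q \<Longrightarrow> dec (\<lambda>r. P r = Q r)"
  using dec_conj[OF dec_imp dec_imp, of P Q Q P] by (simp add: iff_conv_conj_imp)

lemma dec_zero: assumes "cmp F" shows "dec (\<lambda>r. F r = 0)"
proof -
  have "cmp (\<lambda>r. rec_nat 1 (\<lambda>n v. 0) (F r))" by (intro cmp_rec assms cmp_const)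
  moreover have "rec_nat 1 (\<lambda>n v. 0) a = (if a = 0 then 1 else (0::nat))" for a
    by (cases a) auto
  ultimately show ?thesis unfolding dec_def by simp
qed

lemma dec_le: assumes "cmp F" "cmp G" shows "dec (\<lambda>r. F r \<le> G r)"
  using dec_zero[OF cmp_diff[OF assms]] by simp

lemma dec_less: assumes "cmp F" "cmp G" shows "dec (\<lambda>r. F r < G r)"
  using dec_le[OF cmp_Suc assms(2), OF assms(1)] by (simp add: Suc_le_eq)

lemma dec_eq: assumes "cmp F" "cmp G" shows "dec (\<lambda>r. F r = G r)"
  using dec_conj[OF dec_le[OF assms] dec_le[OF assms(2,1)]] by (simp add: eq_iff)

lemma dec_ball_less:
  assumes "dec (\<lambda>r. P (r 0) (\<lambda>i. r (Suc i)))" "cmp B"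
  shows "dec (\<lambda>r. \<forall>z<B r. P z r)"
proof -
  have P: "dec (\<lambda>r. P (r 0) (\<lambda>i. r (Suc (Suc i))))"
    using cmp_weaken[OF assms(1)[unfolded dec_def], of 1] by (simp add: dec_def)
  have "cmp (\<lambda>r. rec_nat 1 (\<lambda>n v. if P n r then v else 0) (B r))"
    by (intro cmp_rec cmp_if cmp_const cmp_var assms P)
  moreover have "rec_nat 1 (\<lambda>n v. if Q n then v else 0) b = (if \<forall>z<b. Q z then 1 else (0::nat))"
    for Q b by (induction b) (auto simp: less_Suc_eq)
  ultimately show ?thesis unfolding dec_def by (simp only:)
qed

lemma dec_bex_less:
  assumes "dec (\<lambda>r. P (r 0) (\<lambda>i. r (Suc i)))" "cmp B"
  shows "dec (\<lambda>r. \<exists>z<B r. P z r)"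
  using dec_not[OF dec_ball_less[of "\<lambda>z r. \<not> P z r", OF dec_not assms(2)]] assms(1) by simp

lemma dec_const: "dec (\<lambda>r. b)"
  unfolding dec_def by (rule cmp_const)

lemma cmp_div: assumes "cmp F" "cmp G" shows "cmp (\<lambda>r. F r div G r)"
proof -
  \<comment> \<open>The disjunct \<open>G r = 0\<close> keeps the search total and makes it return
    0, the value of a division by zero.\<close>
  have "cmp (\<lambda>r. LEAST z. G r = 0 \<or> F r < G r * Suc z)"
  proof (rule cmp_Least)
    show "dec (\<lambda>r. G (\<lambda>i. r (Suc i)) = 0 \<or> F (\<lambda>i. r (Suc i)) < G (\<lambda>i. r (Suc i)) * Suc (r 0))"
      by (intro dec_disj dec_eq dec_less assms[THEN cmp_shift] cmp_const cmp_mult cmp_Suc cmp_var)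
    show "\<exists>z. G r = 0 \<or> F r < G r * Suc z" for r
      by (metis dividend_less_times_div gr0I mult_Suc_right)
  qed
  moreover have "(LEAST z. b = 0 \<or> a < b * Suc z) = a div b" for a b :: nat
  proof (cases "b = 0")
    case False
    show ?thesis
    proof (rule Least_equality)
      show "b = 0 \<or> a < b * Suc (a div b)" using False dividend_less_times_div[of b a] by simp
      show "a div b \<le> z" if "b = 0 \<or> a < b * Suc z" for z
        using that False by (metis less_Suc_eq_le less_mult_imp_div_less mult.commute)
    qed
  qed auto
  ultimately show ?thesis by simp
qed

lemma cmp_mod: assumes "cmp F" "cmp G" shows "cmp (\<lambda>r. F r mod G r)"
  unfolding minus_mult_div_eq_mod[symmetric]
  by (intro cmp_diff cmp_mult cmp_div assms)

lemma cmp_prod_encode: assumes "cmp F" "cmp G" shows "cmp (\<lambda>r. prod_encode (F r, G r))"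
  unfolding prod_encode_def triangle_def prod.case
  by (intro cmp_add cmp_div cmp_mult cmp_Suc cmp_const assms)

lemma cmp_fst_decode: assumes "cmp F" shows "cmp (\<lambda>r. fst (prod_decode (F r)))"
proof -
  have "cmp (\<lambda>r. LEAST z. \<exists>w<Suc (F r). prod_encode (z, w) = F r)"
  proof (rule cmp_Least)
    show "dec (\<lambda>r. \<exists>w<Suc (F (\<lambda>i. r (Suc i))). prod_encode (r 0, w) = F (\<lambda>i. r (Suc i)))"
      by (intro dec_bex_less dec_eq cmp_prod_encode cmp_var cmp_Suc assms[THEN cmp_shift]
        assms[THEN cmp_shift, THEN cmp_shift])
    show "\<exists>z. \<exists>w<Suc (F r). prod_encode (z, w) = F r" for r
      by (metis le_imp_less_Suc le_prod_encode_2 prod.collapse prod_decode_inverse)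
  qed
  moreover have "(LEAST z. \<exists>w<Suc n. prod_encode (z, w) = n) = fst (prod_decode n)" for n
  proof (rule Least_equality)
    show "\<exists>w<Suc n. prod_encode (fst (prod_decode n), w) = n"
      by (metis le_imp_less_Suc le_prod_encode_2 prod.collapse prod_decode_inverse)
  qed auto
  ultimately show ?thesis by simp
qed

lemma cmp_snd_decode: assumes "cmp F" shows "cmp (\<lambda>r. snd (prod_decode (F r)))"
proof -
  have "cmp (\<lambda>r. LEAST z. prod_encode (fst (prod_decode (F r)), z) = F r)"
  proof (rule cmp_Least)
    show "dec (\<lambda>r. prod_encode (fst (prod_decode (F (\<lambda>i. r (Suc i)))), r 0) = F (\<lambda>i. r (Suc i)))"
      by (intro dec_eq cmp_prod_encode cmp_var assms[THEN cmp_shift] cmp_fst_decode)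
    show "\<exists>z. prod_encode (fst (prod_decode (F r)), z) = F r" for r
      by (metis prod.collapse prod_decode_inverse)
  qed
  moreover have "(LEAST z. prod_encode (fst (prod_decode n), z) = n) = snd (prod_decode n)" for n
  proof (rule Least_equality)
    show "prod_encode (fst (prod_decode n), snd (prod_decode n)) = n" by simp
    show "snd (prod_decode n) \<le> z" if "prod_encode (fst (prod_decode n), z) = n" for z
      using that by (metis order_refl prod_encode_inverse snd_conv)
  qed
  ultimately show ?thesis by simp
qed

lemmas computable = cmp_const cmp_var cmp_Suc cmp_add cmp_mult cmp_diff cmp_power cmp_div
  cmp_mod cmp_prod_encode cmp_fst_decode cmp_snd_decode cmp_if dec_const dec_not dec_conj
  dec_disj dec_imp dec_iff dec_eq dec_le dec_less dec_ball_less dec_bex_less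

section \<open>Truth tables of finite structures\<close>

abbreviation p1 :: "nat \<Rightarrow> nat" where "p1 c \<equiv> fst (prod_decode c)"
abbreviation p2 :: "nat \<Rightarrow> nat" where "p2 c \<equiv> snd (prod_decode c)"

lemma p1_le: "p1 c \<le> c" and p2_le: "p2 c \<le> c"
  by (metis le_prod_encode_1 prod.collapse prod_decode_inverse,
      metis le_prod_encode_2 prod.collapse prod_decode_inverse)

lemma prod_encode_mono: "a \<le> a' \<Longrightarrow> b \<le> b' \<Longrightarrow> prod_encode (a, b) \<le> prod_encode (a', b')"
proof -
  assume "a \<le> a'" "b \<le> b'"
  moreover have "m \<le> n \<Longrightarrow> triangle m \<le> triangle n" for m n
    unfolding triangle_def by (intro div_le_mono mult_le_mono) auto
  ultimately show ?thesis by (simp add: prod_encode_def add_mono)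
qed

text \<open>Compound formulas have positive tags, so this gives the strict descent from a code to
  its parts. It fails for the pair of zeros; tag 0 is that of the atoms.\<close>

lemma less_prod_encode_2: "a > 0 \<Longrightarrow> b < prod_encode (a, b)"
proof -
  assume "a > 0"
  moreover have "n \<le> triangle n" for n by (induction n) auto
  from this[of "a + b"] have "a + b \<le> triangle (a + b)" .
  ultimately show ?thesis by (simp add: prod_encode_def)
qed

lemma p2_less: "p1 c > 0 \<Longrightarrow> p2 c < c"
  using less_prod_encode_2[of "p1 c" "p2 c"] by simp

definition digit :: "nat \<Rightarrow> nat \<Rightarrow> nat \<Rightarrow> nat" where
  "digit n t i = t div n ^ i mod n"

lemma digit_less: "n > 0 \<Longrightarrow> digit n t i < n"
  by (simp add: digit_def)

text \<open>Turns quantification over finite functions (assignments, values of constants, truth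
  tables) into bounded quantification over numbers. The induction adds the new value as the most
  significant digit.\<close>

lemma digits_exist:
  assumes n: "n > 0" and f: "\<And>i. i < m \<Longrightarrow> f i < n"
  shows "\<exists>t < n ^ m. \<forall>i<m. digit n t i = f i"
  using f
proof (induction m)
  case 0
  then show ?case by simp
next
  case (Suc m)
  then obtain t where t: "t < n ^ m" "\<forall>i<m. digit n t i = f i" by force
  define u where "u = t + f m * n ^ m"
  have "f m < n" using Suc.prems by simp
  then have "f m * n ^ m + n ^ m \<le> n * n ^ m"
    by (metis add.commute mult_Suc mult_le_mono1 Suc_leI)
  then have "u < n ^ Suc m" using t(1) by (simp add: u_def)
  moreover have "digit n u i = f i" if "i < Suc m" for i
  proof (cases "i = m")
    case True
    then show ?thesis using t(1) \<open>f m < n\<close> n by (simp add: u_def digit_def)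
  next
    case False
    then have i: "i < m" using that by simp
    then obtain j where j: "m = Suc (i + j)" using less_imp_Suc_add by blast
    have "u div n ^ i = t div n ^ i + n * (f m * n ^ j)"
    proof -
      have "u = t + n * (f m * n ^ j) * n ^ i"
        by (simp add: u_def j power_add)
      then show ?thesis using n by simp
    qed
    then have "digit n u i = digit n t i" by (simp add: digit_def)
    then show ?thesis using t(2) i by simp
  qed
  ultimately show ?case by blast
qed

text \<open>The digits of \<open>e\<close> are the values of the variables, those of
  \<open>t\<close> the values of the constants; \<open>s\<close> is the code of a term.\<close>

definition term_value :: "nat \<Rightarrow> nat \<Rightarrow> nat \<Rightarrow> nat \<Rightarrow> nat" where
  "term_value n t e s = (if p1 s = 0 then digit n e (p2 s) else digit n t (p2 s))"

text \<open>The code of a nonempty list is the successor of a pair, hence \<open>v - 1\<close>. The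
  empty list has code 0, and the step keeps it there because
  \<open>prod_decode 0 = (0, 0)\<close>.\<close>

definition code_drop :: "nat \<Rightarrow> nat \<Rightarrow> nat" where
  "code_drop L i = rec_nat L (\<lambda>_ v. p2 (v - 1)) i"

text \<open>Comparing position by position needs only a bounded quantifier. A list is no longer than
  its code, so the range of \<open>i\<close> reaches the ends, where both remainders must become 0
  together.\<close>

definition same_args :: "nat \<Rightarrow> nat \<Rightarrow> nat \<Rightarrow> nat \<Rightarrow> nat \<Rightarrow> nat \<Rightarrow> bool" where
  "same_args n t e L e' L' \<longleftrightarrow>
     (\<forall>i<Suc (L + L'). (code_drop L i = 0 \<longleftrightarrow> code_drop L' i = 0) \<and>
        (code_drop L i = 0 \<or> term_value n t e (p1 (code_drop L i - 1)) =
                             term_value n t e' (p1 (code_drop L' i - 1))))"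

lemma code_drop_encode: "code_drop (list_encode xs) i = list_encode (drop i xs)"
proof (induction i)
  case 0
  then show ?case by (simp add: code_drop_def)
next
  case (Suc i)
  have "prod_encode (0, 0) = 0" by (simp add: prod_encode_def)
  then have "prod_decode 0 = (0, 0)" by (metis prod_encode_inverse)
  then have tl: "p2 (list_encode ys - 1) = list_encode (tl ys)" for ys
    by (cases ys) auto
  have "code_drop (list_encode xs) (Suc i) = p2 (code_drop (list_encode xs) i - 1)"
    by (simp add: code_drop_def)
  also have "\<dots> = list_encode (tl (drop i xs))" by (simp only: Suc tl)
  finally show ?case by (simp only: tl_drop drop_Suc)
qed

lemma list_encode_eq_0: "list_encode xs = 0 \<longleftrightarrow> xs = []"
  by (cases xs) auto

lemma length_le_list_encode: "length xs \<le> list_encode xs"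
proof (induction xs)
  case (Cons x xs)
  then show ?case using le_prod_encode_2[of "list_encode xs" x] by simp
qed simp

lemma elem_le_list_encode: "x \<in> set xs \<Longrightarrow> x \<le> list_encode xs"
proof (induction xs)
  case (Cons y xs)
  then show ?case
    using le_prod_encode_2[of "list_encode xs" y] le_prod_encode_1[of y "list_encode xs"] by auto
qed simp

lemma same_args_encode:
  "same_args n t e (list_encode xs) e' (list_encode ys) \<longleftrightarrow>
     map (term_value n t e) xs = map (term_value n t e') ys"
proof -
  have hd: "p1 (list_encode (drop i zs) - 1) = zs ! i" if "i < length zs" for i zs
    using that by (simp add: Cons_nth_drop_Suc[symmetric])
  show ?thesis
  proof
    assume l: "same_args n t e (list_encode xs) e' (list_encode ys)"
    have l1: "length xs \<le> i \<longleftrightarrow> length ys \<le> i" if "i \<le> list_encode xs + list_encode ys" for i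
      using l that by (auto simp: same_args_def code_drop_encode list_encode_eq_0 less_Suc_eq_le)
    have len: "length xs = length ys"
      using l1[of "length xs"] l1[of "length ys"]
        length_le_list_encode[of xs] length_le_list_encode[of ys] by simp
    have "term_value n t e (xs ! i) = term_value n t e' (ys ! i)" if "i < length xs" for i
    proof -
      have "i < Suc (list_encode xs + list_encode ys)"
        using that length_le_list_encode[of xs] by simp
      then have "term_value n t e (p1 (list_encode (drop i xs) - 1)) =
          term_value n t e' (p1 (list_encode (drop i ys) - 1))"
        using l that by (auto simp: same_args_def code_drop_encode list_encode_eq_0)
      then show ?thesis using hd that len by simp
    qed
    then show "map (term_value n t e) xs = map (term_value n t e') ys"
      using len by (intro nth_equalityI) auto
  next
    assume r: "map (term_value n t e) xs = map (term_value n t e') ys"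
    then have len: "length xs = length ys" by (metis length_map)
    have "term_value n t e (xs ! i) = term_value n t e' (ys ! i)" if "i < length xs" for i
      using r that len by (metis nth_map)
    then show "same_args n t e (list_encode xs) e' (list_encode ys)"
      using len hd by (simp add: same_args_def code_drop_encode list_encode_eq_0)
        (metis One_nat_def not_le)
  qed
qed

lemma same_args_iff:
  "same_args n t e L e' L' \<longleftrightarrow>
     map (term_value n t e) (list_decode L) = map (term_value n t e') (list_decode L')"
  using same_args_encode[of n t e "list_decode L" e' "list_decode L'"] by simp

definition tbl :: "nat \<Rightarrow> nat \<Rightarrow> nat \<Rightarrow> bool" where
  "tbl H c e \<longleftrightarrow> digit 2 H (prod_encode (c, e)) = 1"

text \<open>Tarski's truth clauses as conditions between entries of the table. Predicates are not
  stored: the first clause makes atomic entries with the same predicate name and equal argument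
  values agree, so that an interpretation can be read off. Every tag from 5 on counts as
  \<open>Ex\<close>, so that each number can be read as a formula. Digits up to \<open>q\<close>
  suffice for assignments because the code of a formula bounds its variables.\<close>

definition table_ok :: "nat \<Rightarrow> nat \<Rightarrow> nat \<Rightarrow> nat \<Rightarrow> nat \<Rightarrow> nat \<Rightarrow> bool" where
  "table_ok q n t H c e \<longleftrightarrow>
     (p1 c = 0 \<and> p1 (p2 c) = 0 \<longrightarrow> (\<forall>c'<Suc q. \<forall>e'<n ^ Suc q.
        p1 c' = 0 \<and> p1 (p2 c') = 0 \<and> p1 (p2 (p2 c)) = p1 (p2 (p2 c')) \<and>
        same_args n t e (p2 (p2 (p2 c))) e' (p2 (p2 (p2 c'))) \<longrightarrow> tbl H c e = tbl H c' e')) \<and>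
     (p1 c = 0 \<and> p1 (p2 c) \<noteq> 0 \<longrightarrow>
        tbl H c e = (term_value n t e (p1 (p2 (p2 c))) = term_value n t e (p2 (p2 (p2 c))))) \<and>
     (p1 c = 1 \<longrightarrow> tbl H c e = (\<not> tbl H (p2 c) e)) \<and>
     (p1 c = 2 \<longrightarrow> tbl H c e = (tbl H (p1 (p2 c)) e \<and> tbl H (p2 (p2 c)) e)) \<and>
     (p1 c = 3 \<longrightarrow> tbl H c e = (tbl H (p1 (p2 c)) e \<or> tbl H (p2 (p2 c)) e)) \<and>
     (p1 c = 4 \<longrightarrow> tbl H c e = (\<forall>e'<n ^ Suc q.
        (\<forall>v<Suc q. v \<noteq> p1 (p2 c) \<longrightarrow> digit n e' v = digit n e v) \<longrightarrow> tbl H (p2 (p2 c)) e')) \<and>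
     (p1 c \<ge> 5 \<longrightarrow> tbl H c e = (\<exists>e'<n ^ Suc q.
        (\<forall>v<Suc q. v \<noteq> p1 (p2 c) \<longrightarrow> digit n e' v = digit n e v) \<and> tbl H (p2 (p2 c)) e'))"

text \<open>\<open>prod_encode\<close> is monotone, so the bits of \<open>H\<close> up to
  \<open>prod_encode (q, n ^ Suc q)\<close> include all entries in question.\<close>

definition has_model_table :: "nat \<Rightarrow> nat \<Rightarrow> bool" where
  "has_model_table q n \<longleftrightarrow>
     n > 0 \<and> (\<exists>t < n ^ Suc q. \<exists>H < 2 ^ Suc (prod_encode (q, n ^ Suc q)).
       (\<forall>c<Suc q. \<forall>e<n ^ Suc q. table_ok q n t H c e) \<and> (\<forall>e<n ^ Suc q. tbl H q e))"

section \<open>Computability of the bounded search\<close>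

lemma cmp_digit: "cmp N \<Longrightarrow> cmp T \<Longrightarrow> cmp I \<Longrightarrow> cmp (\<lambda>r. digit (N r) (T r) (I r))"
  unfolding digit_def by (intro computable)

lemma cmp_code_drop: "cmp L \<Longrightarrow> cmp I \<Longrightarrow> cmp (\<lambda>r. code_drop (L r) (I r))"
  unfolding code_drop_def by (intro cmp_rec computable)

lemma cmp_term_value:
  "cmp N \<Longrightarrow> cmp T \<Longrightarrow> cmp E \<Longrightarrow> cmp S \<Longrightarrow> cmp (\<lambda>r. term_value (N r) (T r) (E r) (S r))"
  unfolding term_value_def by (intro cmp_digit computable)

lemma dec_tbl: "cmp H \<Longrightarrow> cmp C \<Longrightarrow> cmp E \<Longrightarrow> dec (\<lambda>r. tbl (H r) (C r) (E r))"
  unfolding tbl_def by (intro cmp_digit computable)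

text \<open>Stated for variables: a binder turns \<open>r a\<close> into \<open>r (Suc a)\<close>,
  which has the same shape, so the rule applies under quantifiers without weakening. The next two
  lemmas have their form for the same reason.\<close>

lemma dec_same_args_var:
  "dec (\<lambda>r. same_args (r a) (r b) (r c) (p2 (p2 (p2 (r d)))) (r e) (p2 (p2 (p2 (r f)))))"
  unfolding same_args_def
  by (intro cmp_digit cmp_code_drop cmp_term_value computable)

lemma dec_table_ok_var: "dec (\<lambda>r. table_ok (r a) (r b) (r c) (r d) (r e) (r f))"
  unfolding table_ok_def
  by (intro cmp_digit cmp_term_value dec_tbl dec_same_args_var computable)

lemma dec_has_model_table_var: "dec (\<lambda>r. has_model_table (r a) (r b))"
  unfolding has_model_table_def
  by (intro dec_tbl dec_table_ok_var computable)

lemma decidable_bounded_model_search: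
  assumes "cmp (\<lambda>r. B (r 0))"
  shows "\<exists>f. recursive 1 f \<and> (\<forall>q. f [q] = (if \<exists>n<Suc (B q). has_model_table q n then 1 else 0))"
proof -
  have "dec (\<lambda>r. \<exists>n<Suc (B (r 0)). has_model_table (r 0) n)"
    by (intro dec_has_model_table_var dec_bex_less cmp_Suc assms)
  from cmp_imp_recursive[OF this[unfolded dec_def]] show ?thesis
    by (intro exI conjI) (auto simp: env_def)
qed

section \<open>Truth tables and finite models\<close>

lemma tm_vars_le_encode: "v \<in> tm_vars s \<Longrightarrow> v \<le> tm_encode s"
  by (cases s) (auto simp: le_prod_encode_2)

lemma less_prod_encode_prod_encode:
  assumes "k > 0"
  shows "i < prod_encode (k, prod_encode (i, j))" "j < prod_encode (k, prod_encode (i, j))"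
  using less_prod_encode_2[OF assms, of "prod_encode (i, j)"] le_prod_encode_1[of i j]
    le_prod_encode_2[of j i] by simp_all

lemma fm_encode_subformula:
  "fm_encode p < fm_encode (Neg p)"
  "fm_encode p < fm_encode (Con p q)" "fm_encode q < fm_encode (Con p q)"
  "fm_encode p < fm_encode (Dis p q)" "fm_encode q < fm_encode (Dis p q)"
  "fm_encode p < fm_encode (All v p)" "v < fm_encode (All v p)"
  "fm_encode p < fm_encode (Ex v p)" "v < fm_encode (Ex v p)"
  by (simp_all add: less_prod_encode_2 less_prod_encode_prod_encode)

lemma tm_encode_args_le:
  "s \<in> set ts \<Longrightarrow> tm_encode s \<le> atom_encode (Pred P ts)"
proof -
  assume "s \<in> set ts"
  then have "tm_encode s \<le> list_encode (map tm_encode ts)" by (intro elem_le_list_encode) auto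
  also have "\<dots> \<le> atom_encode (Pred P ts)"
    by (simp) (meson le_prod_encode_2 le_trans)
  finally show ?thesis .
qed

lemma tm_encode_Eq_le:
  "tm_encode s \<le> atom_encode (Eq s t)" "tm_encode t \<le> atom_encode (Eq s t)"
  by (simp, meson le_prod_encode_1 le_prod_encode_2 le_trans)+

lemma has_model_table_imp_satisfiable:
  assumes "has_model_table (fm_encode p) n"
  shows "satisfiable p"
proof -
  define q where "q = fm_encode p"
  define E where "E = n ^ Suc q"
  obtain t H where n: "n > 0"
    and ok: "\<And>c e. c \<le> q \<Longrightarrow> e < E \<Longrightarrow> table_ok q n t H c e"
    and top: "\<And>e. e < E \<Longrightarrow> tbl H q e"
    using assms unfolding has_model_table_def q_def[symmetric] E_def[symmetric]
    by (auto simp: less_Suc_eq_le)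
  \<comment> \<open>A predicate holds of \<open>us\<close> if some atomic entry with these argument
    values is true; by the first clause of \<open>table_ok\<close> all such entries agree.\<close>
  define M :: "nat struct" where "M = \<lparr>domain = {..<n}, cst = digit n t,
    prd = \<lambda>P us. \<exists>c\<le>q. \<exists>e<E. p1 c = 0 \<and> p1 (p2 c) = 0 \<and> p1 (p2 (p2 c)) = P \<and>
      map (term_value n t e) (list_decode (p2 (p2 (p2 c)))) = us \<and> tbl H c e\<rparr>"
  have dom: "domain M = {..<n}" by (simp add: M_def)
  have M: "is_struct M" using n by (auto simp: is_struct_def M_def digit_less)
  have code: "\<exists>e<E. \<forall>v\<le>q. digit n e v = f v" if "range f \<subseteq> {..<n}" for f
    using digits_exist[of n "Suc q" f] n that
    by (auto simp: E_def less_Suc_eq_le image_subset_iff)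
  have val: "term_value n t e (tm_encode s) = tm_val M f s"
    if "\<forall>v\<le>q. digit n e v = f v" "tm_encode s \<le> q" for e f s
    using that tm_vars_le_encode[of _ s]
    by (cases s) (force simp: term_value_def M_def)+
  have main: "holds M f r \<longleftrightarrow> tbl H (fm_encode r) e"
    if "fm_encode r \<le> q" "range f \<subseteq> {..<n}" "e < E" "\<forall>v\<le>q. digit n e v = f v" for r f e
    using that
  proof (induction r arbitrary: f e)
    case (Atom a)
    note ok = ok[OF Atom.prems(1,3)]
    have aq: "atom_encode a \<le> q"
      using Atom.prems(1) le_prod_encode_2[of "atom_encode a" 0] by simp
    show ?case
    proof (cases a)
      case (Pred P ts)
      have "map (term_value n t e) (map tm_encode ts) = map (tm_val M f) ts"
        using val[OF Atom.prems(4)] aq tm_encode_args_le[of _ ts P] Pred by fastforce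
      then have vals: "map (term_value n t e) (list_decode (p2 (p2 (p2 (fm_encode (Atom a))))))
          = map (tm_val M f) ts" using Pred by simp
      have p: "p1 (fm_encode (Atom a)) = 0" "p1 (p2 (fm_encode (Atom a))) = 0"
        "p1 (p2 (p2 (fm_encode (Atom a)))) = P" using Pred by simp_all
      show ?thesis
      proof
        assume "holds M f (Atom a)"
        then obtain c e' where c: "c \<le> q" "e' < E" "p1 c = 0" "p1 (p2 c) = 0" "p1 (p2 (p2 c)) = P"
          "map (term_value n t e') (list_decode (p2 (p2 (p2 c)))) = map (tm_val M f) ts" "tbl H c e'"
          unfolding Pred by (auto simp: M_def)
        then have "same_args n t e (p2 (p2 (p2 (fm_encode (Atom a))))) e' (p2 (p2 (p2 c)))"
          unfolding same_args_iff vals by simp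
        then have "tbl H (fm_encode (Atom a)) e = tbl H c e'"
          using ok c p unfolding table_ok_def E_def[symmetric] less_Suc_eq_le by blast
        then show "tbl H (fm_encode (Atom a)) e" using c(7) by blast
      next
        assume "tbl H (fm_encode (Atom a)) e"
        then have "prd M P (map (tm_val M f) ts)"
          unfolding M_def struct.select_convs using Atom.prems(1,3) vals p
          by (intro exI[of _ "fm_encode (Atom a)"] exI[of _ e] conjI) (simp_all only: M_def)
        then show "holds M f (Atom a)" using Pred by simp
      qed
    next
      case (Eq s u)
      have "term_value n t e (tm_encode s) = tm_val M f s" "term_value n t e (tm_encode u) = tm_val M f u"
        using val[OF Atom.prems(4), of s] val[OF Atom.prems(4), of u] aq
          tm_encode_Eq_le(1)[of s u] tm_encode_Eq_le(2)[of u s] unfolding Eq by linarith+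
      then show ?thesis using ok Eq unfolding table_ok_def by simp
    qed
  next
    case (Neg r)
    have "fm_encode r \<le> q" using fm_encode_subformula(1)[of r] Neg.prems(1) by linarith
    then show ?case using ok[OF Neg.prems(1,3)] Neg.IH[OF _ Neg.prems(2-4)]
      unfolding table_ok_def by simp
  next
    case (Con r s)
    have "fm_encode r \<le> q" "fm_encode s \<le> q"
      using fm_encode_subformula(2)[of r s] fm_encode_subformula(3)[of s r] Con.prems(1)
      by linarith+
    then show ?case
      using ok[OF Con.prems(1,3)] Con.IH(1)[OF _ Con.prems(2-4)] Con.IH(2)[OF _ Con.prems(2-4)]
      unfolding table_ok_def by simp
  next
    case (Dis r s)
    have "fm_encode r \<le> q" "fm_encode s \<le> q"
      using fm_encode_subformula(4)[of r s] fm_encode_subformula(5)[of s r] Dis.prems(1)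
      by linarith+
    then show ?case
      using ok[OF Dis.prems(1,3)] Dis.IH(1)[OF _ Dis.prems(2-4)] Dis.IH(2)[OF _ Dis.prems(2-4)]
      unfolding table_ok_def by simp
  next
    case (All v r)
    have le: "fm_encode r \<le> q" "v \<le> q"
      using fm_encode_subformula(6)[of r v] fm_encode_subformula(7)[of v r] All.prems(1)
      by linarith+
    have "tbl H (fm_encode (All v r)) e \<longleftrightarrow> (\<forall>e'<E.
        (\<forall>u\<le>q. u \<noteq> v \<longrightarrow> digit n e' u = digit n e u) \<longrightarrow> tbl H (fm_encode r) e')"
      using ok[OF All.prems(1,3)] unfolding table_ok_def E_def by (simp add: less_Suc_eq_le)
    also have "\<dots> \<longleftrightarrow> (\<forall>d<n. holds M (f(v := d)) r)"
    proof (intro iffI allI impI)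
      fix d assume L: "\<forall>e'<E. (\<forall>u\<le>q. u \<noteq> v \<longrightarrow> digit n e' u = digit n e u) \<longrightarrow> tbl H (fm_encode r) e'"
        and d: "d < n"
      have rg: "range (f(v := d)) \<subseteq> {..<n}" using d All.prems(2) by auto
      from code[OF this] obtain e' where e': "e' < E" "\<forall>u\<le>q. digit n e' u = (f(v := d)) u" by blast
      then have "tbl H (fm_encode r) e'" using L All.prems(4) by simp
      then show "holds M (f(v := d)) r" using All.IH[OF le(1) rg e'] by blast
    next
      fix e' assume R: "\<forall>d<n. holds M (f(v := d)) r" and e': "e' < E"
        "\<forall>u\<le>q. u \<noteq> v \<longrightarrow> digit n e' u = digit n e u"
      have d: "digit n e' v < n" using n by (rule digit_less)
      have rg: "range (f(v := digit n e' v)) \<subseteq> {..<n}" using d All.prems(2) by auto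
      have "\<forall>u\<le>q. digit n e' u = (f(v := digit n e' v)) u" using e' All.prems(4) by simp
      from All.IH[OF le(1) rg e'(1) this] R d show "tbl H (fm_encode r) e'" by blast
    qed
    finally show ?case using dom by auto
  next
    case (Ex v r)
    have le: "fm_encode r \<le> q" "v \<le> q"
      using fm_encode_subformula(8)[of r v] fm_encode_subformula(9)[of v r] Ex.prems(1)
      by linarith+
    have "tbl H (fm_encode (Ex v r)) e \<longleftrightarrow> (\<exists>e'<E.
        (\<forall>u\<le>q. u \<noteq> v \<longrightarrow> digit n e' u = digit n e u) \<and> tbl H (fm_encode r) e')"
      using ok[OF Ex.prems(1,3)] unfolding table_ok_def E_def by (simp add: less_Suc_eq_le)
    also have "\<dots> \<longleftrightarrow> (\<exists>d<n. holds M (f(v := d)) r)"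
    proof
      assume "\<exists>d<n. holds M (f(v := d)) r"
      then obtain d where d: "d < n" "holds M (f(v := d)) r" by blast
      have rg: "range (f(v := d)) \<subseteq> {..<n}" using d Ex.prems(2) by auto
      from code[OF this] obtain e' where e': "e' < E" "\<forall>u\<le>q. digit n e' u = (f(v := d)) u" by blast
      have "tbl H (fm_encode r) e'" using d(2) Ex.IH[OF le(1) rg e'] by blast
      then show "\<exists>e'<E. (\<forall>u\<le>q. u \<noteq> v \<longrightarrow> digit n e' u = digit n e u) \<and> tbl H (fm_encode r) e'"
        using e' Ex.prems(4) by auto
    next
      assume "\<exists>e'<E. (\<forall>u\<le>q. u \<noteq> v \<longrightarrow> digit n e' u = digit n e u) \<and> tbl H (fm_encode r) e'"
      then obtain e' where e': "e' < E"
        "\<forall>u\<le>q. u \<noteq> v \<longrightarrow> digit n e' u = digit n e u" "tbl H (fm_encode r) e'" by blast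
      have d: "digit n e' v < n" using n by (rule digit_less)
      have rg: "range (f(v := digit n e' v)) \<subseteq> {..<n}" using d Ex.prems(2) by auto
      have "\<forall>u\<le>q. digit n e' u = (f(v := digit n e' v)) u" using e' Ex.prems(4) by simp
      from Ex.IH[OF le(1) rg e'(1) this] e'(3) d show "\<exists>d<n. holds M (f(v := d)) r" by blast
    qed
    finally show ?case using dom by auto
  qed
  have "models M p"
    unfolding models_def dom
  proof (intro allI impI)
    fix f :: "nat \<Rightarrow> nat" assume f: "range f \<subseteq> {..<n}"
    from code[OF f] obtain e where "e < E" "\<forall>v\<le>q. digit n e v = f v" by blast
    then show "holds M f p" using main[OF _ f] top by (simp add: q_def)
  qed
  with M show ?thesis unfolding satisfiable_def by blast
qed

definition tm_decode :: "nat \<Rightarrow> tm" where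
  "tm_decode s = (if p1 s = 0 then Var (p2 s) else Const (p2 s))"

definition atom_decode :: "nat \<Rightarrow> atom" where
  "atom_decode a =
     (if p1 a = 0 then Pred (p1 (p2 a)) (map tm_decode (list_decode (p2 (p2 a))))
      else Eq (tm_decode (p1 (p2 a))) (tm_decode (p2 (p2 a))))"

text \<open>Total, so that a truth table can be filled in for every number and not only for those that
  are codes of formulas.\<close>

function fm_decode :: "nat \<Rightarrow> fm" where
  "fm_decode c =
     (if p1 c = 0 then Atom (atom_decode (p2 c))
      else if p1 c = 1 then Neg (fm_decode (p2 c))
      else if p1 c = 2 then Con (fm_decode (p1 (p2 c))) (fm_decode (p2 (p2 c)))
      else if p1 c = 3 then Dis (fm_decode (p1 (p2 c))) (fm_decode (p2 (p2 c)))
      else if p1 c = 4 then All (p1 (p2 c)) (fm_decode (p2 (p2 c)))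
      else Ex (p1 (p2 c)) (fm_decode (p2 (p2 c))))"
  by auto
termination
  by (relation "measure id")
    (simp_all add: p2_less le_less_trans[OF p1_le p2_less] le_less_trans[OF p2_le p2_less])

declare fm_decode.simps [simp del]

lemma tm_decode_encode: "tm_decode (tm_encode s) = s"
  by (cases s) (auto simp: tm_decode_def)

lemma atom_decode_encode: "atom_decode (atom_encode a) = a"
  by (cases a) (auto simp: atom_decode_def tm_decode_encode comp_def)

lemma fm_decode_encode: "fm_decode (fm_encode p) = p"
  by (induction p) (subst fm_decode.simps; simp add: atom_decode_encode)+

lemma model_imp_has_model_table:
  fixes M :: "nat struct"
  assumes M: "is_struct M" and dom: "domain M = {..<n}" and mod: "models M p"
  shows "has_model_table (fm_encode p) n"
proof -
  define q where "q = fm_encode p"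
  define E where "E = n ^ Suc q"
  have n: "n > 0" using M dom by (auto simp: is_struct_def)
  have "cst M c < n" for c using M dom by (auto simp: is_struct_def)
  then obtain t where t: "t < E" "\<forall>c\<le>q. digit n t c = cst M c"
    using digits_exist[of n "Suc q" "cst M"] n by (auto simp: E_def less_Suc_eq_le)
  define h where "h i = (if holds M (digit n (p2 i)) (fm_decode (p1 i)) then 1 else (0::nat))" for i
  obtain H where H: "H < 2 ^ Suc (prod_encode (q, E))"
    "\<forall>i<Suc (prod_encode (q, E)). digit 2 H i = h i"
  proof -
    have "h i < 2" for i by (simp add: h_def)
    then show ?thesis
      using digits_exist[of 2 "Suc (prod_encode (q, E))" h] that by auto
  qed
  have tbl: "tbl H c e \<longleftrightarrow> holds M (digit n e) (fm_decode c)" if "c \<le> q" "e < E" for c e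
    using H(2) prod_encode_mono[OF that(1), of e E] that(2)
    by (simp add: tbl_def less_Suc_eq_le h_def)
  have val: "term_value n t e s = tm_val M (digit n e) (tm_decode s)" if "s \<le> q" for e s
    using that t(2) p2_le[of s] by (auto simp: term_value_def tm_decode_def)
  have vals: "map (term_value n t e) (list_decode L) =
      map (tm_val M (digit n e)) (map tm_decode (list_decode L))" if "L \<le> q" for e L
    using that elem_le_list_encode[of _ "list_decode L"] val by fastforce
  \<comment> \<open>On the variables of \<open>r\<close>, the assignments coded below
    \<open>E\<close> that agree with \<open>e\<close> up to \<open>q\<close> except at
    \<open>v\<close> are exactly the updates of \<open>e\<close> at \<open>v\<close>.\<close>
  have upd: "(\<forall>d\<in>domain M. holds M ((digit n e)(v := d)) r) \<longleftrightarrow>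
      (\<forall>e'<E. (\<forall>u\<le>q. u \<noteq> v \<longrightarrow> digit n e' u = digit n e u) \<longrightarrow> holds M (digit n e') r)"
    if r: "\<And>u. u \<in> all_vars r \<Longrightarrow> u \<le> q" for e v r
  proof (intro iffI ballI allI impI)
    fix e' assume L: "\<forall>d\<in>domain M. holds M ((digit n e)(v := d)) r" and e': "e' < E"
      "\<forall>u\<le>q. u \<noteq> v \<longrightarrow> digit n e' u = digit n e u"
    have "holds M ((digit n e)(v := digit n e' v)) r" using L digit_less[OF n] dom by simp
    then show "holds M (digit n e') r"
      by (rule holds_cong[THEN iffD1, rotated]) (use r e' in auto)
  next
    fix d assume R: "\<forall>e'<E. (\<forall>u\<le>q. u \<noteq> v \<longrightarrow> digit n e' u = digit n e u) \<longrightarrow> holds M (digit n e') r"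
      and d: "d \<in> domain M"
    have "\<exists>e'<E. \<forall>u\<le>q. digit n e' u = ((digit n e)(v := d)) u"
      using digits_exist[of n "Suc q" "(digit n e)(v := d)"] n d dom digit_less[OF n]
      by (auto simp: E_def less_Suc_eq_le)
    then obtain e' where e': "e' < E" "\<forall>u\<le>q. digit n e' u = ((digit n e)(v := d)) u" by blast
    then have "holds M (digit n e') r" using R by simp
    then show "holds M ((digit n e)(v := d)) r"
      by (rule holds_cong[THEN iffD1, rotated]) (use r e' in auto)
  qed
  have tmv: "u \<le> s" if "u \<in> tm_vars (tm_decode s)" for u s
    using that p2_le[of s] by (auto simp: tm_decode_def split: if_splits)
  have atv: "u \<le> a" if u: "u \<in> atom_vars (atom_decode a)" for u a
  proof (cases "p1 a = 0")
    case True
    then obtain s where "s \<in> set (list_decode (p2 (p2 a)))" "u \<in> tm_vars (tm_decode s)"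
      using u by (auto simp: atom_decode_def)
    then have "u \<le> p2 (p2 a)"
      using tmv elem_le_list_encode[of s "list_decode (p2 (p2 a))"] by fastforce
    then show ?thesis using p2_le[of a] p2_le[of "p2 a"] by simp
  next
    case False
    then have "u \<le> p1 (p2 a) \<or> u \<le> p2 (p2 a)"
      using u tmv by (auto simp: atom_decode_def)
    then show ?thesis using p2_le[of a] p2_le[of "p2 a"] p1_le[of "p2 a"] by auto
  qed
  \<comment> \<open>Needed for every \<open>c\<close>, whether or not it is the code of a formula:
    \<open>table_ok\<close> is required of all \<open>c\<close> up to \<open>q\<close>, and
    \<open>upd\<close> applies to formulas with variables up to \<open>q\<close>.\<close>
  have fmv: "u \<le> c" if "u \<in> all_vars (fm_decode c)" for u c
    using that
  proof (induction c rule: less_induct)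
    case (less c)
    show ?case
    proof (cases "p1 c = 0")
      case True
      then have "u \<le> p2 c" using less.prems atv by (simp add: fm_decode.simps[of c])
      then show ?thesis using p2_le[of c] by simp
    next
      case False
      then have lt: "p2 c < c" "p1 (p2 c) < c" "p2 (p2 c) < c"
        using p2_less[of c] p2_le[of "p2 c"] p1_le[of "p2 c"] by auto
      have "u \<in> all_vars (fm_decode (p2 c)) \<or> u \<in> all_vars (fm_decode (p1 (p2 c))) \<or>
          u \<in> all_vars (fm_decode (p2 (p2 c))) \<or> u = p1 (p2 c)"
        using less.prems False by (auto simp: fm_decode.simps[of c] split: if_splits)
      then show ?thesis using less.IH[OF lt(1)] less.IH[OF lt(2)] less.IH[OF lt(3)] lt by auto
    qed
  qed
  have ok: "table_ok q n t H c e" if c: "c \<le> q" and e: "e < E" for c e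
  proof -
    have q2: "p2 c \<le> q" "p1 (p2 c) \<le> q" "p2 (p2 c) \<le> q" "p1 (p2 (p2 c)) \<le> q" "p2 (p2 (p2 c)) \<le> q"
      if "c \<le> q" for c
      using that p2_le[of c] p1_le[of "p2 c"] p2_le[of "p2 c"] p1_le[of "p2 (p2 c)"] p2_le[of "p2 (p2 c)"]
      by auto
    note tb = tbl[OF c e] tbl[OF q2(1)[OF c] e] tbl[OF q2(2)[OF c] e] tbl[OF q2(3)[OF c] e]
    have fv: "u \<le> q" if "u \<in> all_vars (fm_decode (p2 (p2 c)))" for u
      using fmv[OF that] q2(3)[OF c] by simp
    have args: "tbl H c e = tbl H c' e'"
      if "p1 c = 0 \<and> p1 (p2 c) = 0" "c' \<le> q" "e' < E" "p1 c' = 0 \<and> p1 (p2 c') = 0 \<and>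
        p1 (p2 (p2 c)) = p1 (p2 (p2 c')) \<and>
        same_args n t e (p2 (p2 (p2 c))) e' (p2 (p2 (p2 c')))" for c' e'
    proof -
      have "map (tm_val M (digit n e)) (map tm_decode (list_decode (p2 (p2 (p2 c))))) =
          map (tm_val M (digit n e')) (map tm_decode (list_decode (p2 (p2 (p2 c')))))"
        using that vals[OF q2(5)[OF c]] vals[OF q2(5)[OF that(2)]] by (simp only: same_args_iff)
      then show ?thesis
        using that unfolding tb(1) tbl[OF that(2,3)]
        by (simp add: fm_decode.simps[of c] fm_decode.simps[of c'] atom_decode_def del: map_map)
    qed
    have eqn: "tbl H c e = (term_value n t e (p1 (p2 (p2 c))) = term_value n t e (p2 (p2 (p2 c))))"
      if "p1 c = 0" "p1 (p2 c) \<noteq> 0"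
      using that unfolding tb(1) val[OF q2(4)[OF c]] val[OF q2(5)[OF c]]
      by (simp add: fm_decode.simps[of c] atom_decode_def)
    have all: "tbl H c e = (\<forall>e'<E. (\<forall>v\<le>q. v \<noteq> p1 (p2 c) \<longrightarrow> digit n e' v = digit n e v) \<longrightarrow>
        tbl H (p2 (p2 c)) e')" if "p1 c = 4"
      using that upd[where r = "fm_decode (p2 (p2 c))" and e = e and v = "p1 (p2 c)"] fv tbl[OF q2(3)[OF c]]
      unfolding tb(1) by (simp add: fm_decode.simps[of c])
    \<comment> \<open>The clause for \<open>Ex\<close> is \<open>upd\<close> for the negated
      body.\<close>
    have ex: "tbl H c e = (\<exists>e'<E. (\<forall>v\<le>q. v \<noteq> p1 (p2 c) \<longrightarrow> digit n e' v = digit n e v) \<and>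
        tbl H (p2 (p2 c)) e')" if "p1 c \<ge> 5"
      using that upd[where r = "Neg (fm_decode (p2 (p2 c)))" and e = e and v = "p1 (p2 c)"] fv tbl[OF q2(3)[OF c]]
      unfolding tb(1) by (simp add: fm_decode.simps[of c]) blast
    show ?thesis
      unfolding table_ok_def E_def[symmetric] less_Suc_eq_le
      using args eqn all ex tb by (simp add: fm_decode.simps[of c])
  qed
  have top: "tbl H q e" if "e < E" for e
    using tbl[OF order_refl that] mod dom digit_less[OF n]
    by (auto simp: q_def fm_decode_encode models_def)
  show ?thesis
    unfolding has_model_table_def q_def[symmetric] E_def[symmetric]
    using n t(1) H(1) ok top by (auto simp: less_Suc_eq_le)
qed

text \<open>Tables describe structures on \<open>{..<n}\<close>. An enumeration of the domain
  carries any finite model there, in particular the copy built below on a sum type.\<close>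

lemma finite_model_imp_has_model_table:
  fixes N :: "'u struct"
  assumes N: "is_struct N" and fin: "finite (domain N)" and mod: "models N p"
  shows "has_model_table (fm_encode p) (card (domain N))"
proof -
  obtain h where "bij_betw h (domain N) {0..<card (domain N)}"
    using ex_bij_betw_finite_nat[OF fin] by blast
  then have h: "bij_betw h (domain N) {..<card (domain N)}" by (simp add: atLeast0LessThan)
  define g where "g = inv_into (domain N) h"
  have gh: "g (h d) = d" if "d \<in> domain N" for d
    using bij_betw_inv_into_left[OF h that] by (simp add: g_def)
  have hdom: "h ` domain N = {..<card (domain N)}" using h by (simp add: bij_betw_def)
  define M :: "nat struct" where "M = \<lparr>domain = {..<card (domain N)}, cst = h \<circ> cst N,
    prd = \<lambda>P us. prd N P (map g us)\<rparr>"
  have cN: "cst N c \<in> domain N" for c using N by (auto simp: is_struct_def)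
  have M: "is_struct M"
    using N fin hdom cN by (auto simp: is_struct_def M_def card_gt_0_iff)
  have tvN: "tm_val N e t \<in> domain N" if "range e \<subseteq> domain N" for e t
    using that cN by (cases t) auto
  have tv: "tm_val M (h \<circ> e) t = h (tm_val N e t)" for e t
    by (cases t) (auto simp: M_def)
  have main: "holds M (h \<circ> e) r = holds N e r" if "range e \<subseteq> domain N" for e r
    using that
  proof (induction r arbitrary: e)
    case (Atom a)
    show ?case
    proof (cases a)
      case (Pred P ts)
      have "map g (map (tm_val M (h \<circ> e)) ts) = map (tm_val N e) ts"
        using tvN[OF Atom] gh by (simp add: tv)
      moreover have "prd M P us = prd N P (map g us)" for us by (simp add: M_def)
      ultimately show ?thesis unfolding Pred holds.simps atom_holds.simps by (simp only:)
    next
      case (Eq s t)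
      show ?thesis unfolding Eq holds.simps atom_holds.simps tv
        using gh tvN[OF Atom] by metis
    qed
  next
    case (All v r)
    have "holds M ((h \<circ> e)(v := h d)) r = holds N (e(v := d)) r" if "d \<in> domain N" for d
    proof -
      have "range (e(v := d)) \<subseteq> domain N" using All.prems that by auto
      from All.IH[OF this] show ?thesis unfolding fun_upd_comp .
    qed
    moreover have "domain M = h ` domain N" by (simp add: M_def hdom)
    ultimately show ?case by (simp del: fun_upd_apply comp_apply add: comp_def)
  next
    case (Ex v r)
    have "holds M ((h \<circ> e)(v := h d)) r = holds N (e(v := d)) r" if "d \<in> domain N" for d
    proof -
      have "range (e(v := d)) \<subseteq> domain N" using Ex.prems that by auto
      from Ex.IH[OF this] show ?thesis unfolding fun_upd_comp .
    qed
    moreover have "domain M = h ` domain N" by (simp add: M_def hdom)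
    ultimately show ?case by (simp del: fun_upd_apply comp_apply add: comp_def)
  qed auto
  have "models M p"
    unfolding models_def
  proof (intro allI impI)
    fix e :: "nat \<Rightarrow> nat" assume "range e \<subseteq> domain M"
    then have e: "e i \<in> h ` domain N" for i by (auto simp: M_def hdom)
    have "h (g (e i)) = e i" for i using e[of i] gh by auto
    then have "h \<circ> (g \<circ> e) = e" by auto
    moreover have r: "range (g \<circ> e) \<subseteq> domain N"
    proof -
      have "g (e i) \<in> domain N" for i using e[of i] gh by auto
      then show ?thesis by auto
    qed
    ultimately show "holds M e p" using main[OF r, of p] mod by (simp add: models_def)
  qed
  then show ?thesis using model_imp_has_model_table[OF M] by (simp add: M_def)
qed

section \<open>Quantifier prefixes as games\<close>

type_synonym quants = "(bool \<times> nat) list"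

fun quantify :: "quants \<Rightarrow> fm \<Rightarrow> fm" where
  "quantify [] m = m"
| "quantify ((b, v) # qs) m = (if b then All v (quantify qs m) else Ex v (quantify qs m))"

definition linear :: "prefix \<Rightarrow> quants" where
  "linear bs = concat (map (\<lambda>(xs, ys). map (Pair True) xs @ map (Pair False) ys) bs)"

lemma quantify_append: "quantify (qs @ qs') m = quantify qs (quantify qs' m)"
  by (induction qs) auto

lemma quantify_All: "quantify (map (Pair True) xs) m = foldr All xs m"
  by (induction xs) auto

lemma quantify_Ex: "quantify (map (Pair False) xs) m = foldr Ex xs m"
  by (induction xs) auto

lemma close_eq_quantify: "close bs m = quantify (linear bs) m"
  by (induction bs m rule: close.induct)
    (auto simp: linear_def quantify_append quantify_All quantify_Ex)

lemma atoms_quantify: "atoms (quantify qs m) = atoms m"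
  by (induction qs m rule: quantify.induct) auto

lemma length_le_encode_quantify: "length qs \<le> fm_encode (quantify qs m)"
proof (induction qs m rule: quantify.induct)
  case (2 b v qs m)
  then show ?case
    using fm_encode_subformula(6)[of "quantify qs m" v] fm_encode_subformula(8)[of "quantify qs m" v]
    by (cases b) (simp_all del: fm_encode.simps)
qed simp

lemma atom_encode_le: "a \<in> atoms p \<Longrightarrow> atom_encode a \<le> fm_encode p"
proof (induction p)
  case (Atom b)
  then show ?case by (simp add: le_prod_encode_2)
next
  case (Neg p)
  then show ?case using fm_encode_subformula(1)[of p] by (simp del: fm_encode.simps)
next
  case (Con p q)
  then show ?case using fm_encode_subformula(2)[of p q] fm_encode_subformula(3)[of q p]
    by (auto simp del: fm_encode.simps)
next
  case (Dis p q)
  then show ?case using fm_encode_subformula(4)[of p q] fm_encode_subformula(5)[of q p]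
    by (auto simp del: fm_encode.simps)
next
  case (All v p)
  then show ?case using fm_encode_subformula(6)[of p v] by (simp del: fm_encode.simps)
next
  case (Ex v p)
  then show ?case using fm_encode_subformula(8)[of p v] by (simp del: fm_encode.simps)
qed

text \<open>Each variable has its own domain, so that universal moves can be confined to
  representatives and existential ones to finite sets independently. The winning condition is an
  arbitrary predicate, which keeps formulas out of the arguments about strategies.\<close>

fun game :: "(nat \<Rightarrow> 'u set) \<Rightarrow> ((nat \<Rightarrow> 'u) \<Rightarrow> bool) \<Rightarrow> quants \<Rightarrow> (nat \<Rightarrow> 'u) \<Rightarrow> bool" where
  "game D W [] e = W e"
| "game D W ((b, v) # qs) e =
     (if b then \<forall>d\<in>D v. game D W qs (e(v := d)) else \<exists>d\<in>D v. game D W qs (e(v := d)))"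

lemma holds_quantify:
  "holds M e (quantify qs m) = game (\<lambda>_. domain M) (\<lambda>e. holds M e m) qs e"
  by (induction qs arbitrary: e) auto

lemma game_mono:
  assumes "game D W qs e"
    and "\<And>v. (True, v) \<in> set qs \<Longrightarrow> D' v \<subseteq> D v"
    and "\<And>v. (False, v) \<in> set qs \<Longrightarrow> D v \<subseteq> D' v"
  shows "game D' W qs e"
  using assms
proof (induction qs arbitrary: e)
  case (Cons bv qs)
  obtain b v where bv: "bv = (b, v)" by force
  show ?case
  proof (cases b)
    case True
    then show ?thesis using Cons bv by (auto simp del: fun_upd_apply)
  next
    case False
    then obtain d where "d \<in> D v" "game D W qs (e(v := d))" using Cons.prems(1) bv by auto
    moreover have "D v \<subseteq> D' v" using Cons.prems(3) False bv by simp
    moreover have "game D' W qs (e(v := d))"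
      using Cons.IH[OF \<open>game D W qs (e(v := d))\<close>] Cons.prems(2,3) bv
      by (simp del: fun_upd_apply)
    ultimately show ?thesis using False bv by auto
  qed
qed simp

lemma card_UN_bounded:
  assumes "finite I" "card I \<le> n" "\<And>i. i \<in> I \<Longrightarrow> card (A i) \<le> b"
  shows "card (\<Union>i\<in>I. A i) \<le> n * b"
proof -
  have "card (\<Union>i\<in>I. A i) \<le> (\<Sum>i\<in>I. card (A i))" by (rule card_UN_le[OF assms(1)])
  also have "\<dots> \<le> of_nat (card I) * b" by (rule sum_bounded_above) (rule assms(3))
  also have "\<dots> \<le> n * b" using assms(2) by simp
  finally show ?thesis .
qed

text \<open>With finitely many universal moves a winning strategy is a finite tree, and
  \<open>F\<close> collects the existential values on it. In
  \<open>Suc N ^ Suc l = Suc N ^ l + N * Suc N ^ l\<close> the second summand pays for the branching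
  at a universal variable, or for the one new value at an existential variable.\<close>

lemma finitely_many_witnesses:
  assumes "game D W qs e"
    and "\<And>b v. (b, v) \<in> set qs \<Longrightarrow> b \<longleftrightarrow> v \<in> U"
    and "\<And>v. v \<in> U \<Longrightarrow> finite (D v) \<and> card (D v) \<le> N"
    and "\<And>v. v \<notin> U \<Longrightarrow> D v \<subseteq> S"
    and "N > 0"
  shows "\<exists>F. finite F \<and> F \<subseteq> S \<and> card F \<le> Suc N ^ length qs \<and>
    game (\<lambda>v. if v \<in> U then D v else D v \<inter> F) W qs e"
  using assms(1,2)
proof (induction qs arbitrary: e)
  case Nil
  then show ?case by (intro exI[of _ "{}"]) auto
next
  case (Cons bv qs)
  obtain b v where bv: "bv = (b, v)" by force
  have b: "b \<longleftrightarrow> v \<in> U" using Cons.prems(2) bv by auto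
  note IH = Cons.IH[OF _ Cons.prems(2)[OF list.set_intros(2)]]
  show ?case
  proof (cases b)
    case True
    then have "\<forall>d\<in>D v. \<exists>F. finite F \<and> F \<subseteq> S \<and> card F \<le> Suc N ^ length qs \<and>
        game (\<lambda>v. if v \<in> U then D v else D v \<inter> F) W qs (e(v := d))"
      using Cons.prems(1) bv IH by (simp del: fun_upd_apply)
    from bchoice[OF this] obtain G where G: "\<And>d. d \<in> D v \<Longrightarrow> finite (G d) \<and> G d \<subseteq> S \<and>
        card (G d) \<le> Suc N ^ length qs \<and>
        game (\<lambda>v. if v \<in> U then D v else D v \<inter> G d) W qs (e(v := d))" by blast
    define F where "F = (\<Union>d\<in>D v. G d)"
    have Dv: "finite (D v)" "card (D v) \<le> N" using assms(3) b True by auto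
    have "card F \<le> N * Suc N ^ length qs"
      unfolding F_def by (rule card_UN_bounded) (use Dv G in auto)
    moreover have "game (\<lambda>v. if v \<in> U then D v else D v \<inter> F) W qs (e(v := d))" if "d \<in> D v" for d
      by (rule game_mono[OF G[OF that, THEN conjunct2, THEN conjunct2, THEN conjunct2]])
        (use that Cons.prems(2) in \<open>auto simp: F_def\<close>)
    ultimately show ?thesis
      using True b bv Dv G by (intro exI[of _ F]) (auto simp: F_def)
  next
    case False
    then obtain d where d: "d \<in> D v" "game D W qs (e(v := d))" using Cons.prems(1) bv by auto
    from IH[OF d(2)] obtain F where F: "finite F" "F \<subseteq> S" "card F \<le> Suc N ^ length qs"
      "game (\<lambda>v. if v \<in> U then D v else D v \<inter> F) W qs (e(v := d))" by blast
    have "card (insert d F) \<le> Suc (card F)" using F(1) by (simp add: card_insert_if)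
    also have "\<dots> \<le> Suc N ^ length qs + N * Suc N ^ length qs"
    proof -
      have "1 \<le> N * Suc N ^ length qs" using \<open>N > 0\<close> by (simp add: Suc_le_eq)
      then show ?thesis using F(3) by linarith
    qed
    finally have "card (insert d F) \<le> Suc N ^ length (bv # qs)" by simp
    moreover have "game (\<lambda>v. if v \<in> U then D v else D v \<inter> insert d F) W qs (e(v := d))"
      by (rule game_mono[OF F(4)]) (use Cons.prems(2) in auto)
    ultimately show ?thesis
      using False b bv d F(1,2) assms(4)[of v] by (intro exI[of _ "insert d F"]) auto
  qed
qed

lemma holds_qfree_cong:
  assumes "qfree m" "\<And>a. a \<in> atoms m \<Longrightarrow> atom_holds M e a = atom_holds M' e' a"
  shows "holds M e m = holds M' e' m"
  using assms by (induction m) auto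

section \<open>Confining the global variables to a finite set\<close>

lemma set_encode_less: "A \<subseteq> {..<n} \<Longrightarrow> set_encode A < 2 ^ n"
proof -
  assume "A \<subseteq> {..<n}"
  then have "set_encode A \<le> (\<Sum>i<n. 2 ^ i)"
    unfolding set_encode_def by (intro sum_mono2) auto
  also have "\<dots> < 2 ^ n" by (induction n) auto
  finally show ?thesis .
qed

text \<open>Bounds the number of states defined below: a leaf is a set of atom codes up to
  \<open>q\<close>, and each quantifier may pass to sets of the previous states.\<close>

definition tower :: "nat \<Rightarrow> nat \<Rightarrow> nat" where
  "tower q k = rec_nat (2 ^ Suc q) (\<lambda>_ s. 2 ^ s) k"

lemma tower_simps: "tower q 0 = 2 ^ Suc q" "tower q (Suc k) = 2 ^ tower q k"
  by (simp_all add: tower_def)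

lemma tower_mono: "k \<le> l \<Longrightarrow> tower q k \<le> tower q l"
  by (rule lift_Suc_mono_le[of "tower q"]) (simp_all add: tower_simps less_imp_le)

text \<open>The existential variables split into global ones, with \<open>own y = None\<close>, and those local to a
  universal variable \<open>x\<close>, with \<open>own y = Some x\<close>: conditions (c.1) and (c.2), respectively.\<close>

locale ackermann_partition =
  fixes U :: "nat set" and At0 :: "atom set" and Atx :: "nat \<Rightarrow> atom set"
    and own :: "nat \<Rightarrow> nat option" and q :: nat
  assumes At0_U: "vars At0 \<inter> U = {}"
    and Atx_U: "\<And>x. x \<in> U \<Longrightarrow> vars (Atx x) \<inter> U = {x}"
    and own_Some: "\<And>x y. own y = Some x \<Longrightarrow> x \<in> U \<and> y \<notin> U \<and> y \<notin> vars At0"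
    and own_unique: "\<And>x x' y. own y = Some x \<Longrightarrow> x' \<in> U \<Longrightarrow> y \<in> vars (Atx x') \<Longrightarrow> x' = x"
    and code_le: "\<And>a. a \<in> At0 \<or> (\<exists>x\<in>U. a \<in> Atx x) \<Longrightarrow> atom_encode a \<le> q"
begin

text \<open>The index comparisons of (c.1) and (c.2), rephrased for recursion along the prefix, with
  \<open>V\<close> the variables already chosen. The atoms of a universal variable involve only
  globals chosen before it and locals chosen after it.\<close>

fun ordered :: "nat set \<Rightarrow> quants \<Rightarrow> bool" where
  "ordered V [] \<longleftrightarrow> True"
| "ordered V ((True, x) # qs) \<longleftrightarrow> x \<in> U \<and> x \<notin> V \<and>
     (\<forall>v\<in>vars (Atx x). v \<notin> U \<longrightarrow> (case own v of None \<Rightarrow> v \<in> V | Some x' \<Rightarrow> (False, v) \<in> set qs)) \<and>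
     ordered (insert x V) qs"
| "ordered V ((False, y) # qs) \<longleftrightarrow> y \<notin> U \<and> y \<notin> V \<and>
     (case own y of None \<Rightarrow> \<forall>x\<in>V \<inter> U. y \<notin> vars (Atx x) | Some x \<Rightarrow> x \<in> V) \<and>
     ordered (insert y V) qs"

lemma ordered_iff: "ordered V qs \<Longrightarrow> (b, v) \<in> set qs \<Longrightarrow> b \<longleftrightarrow> v \<in> U"
  by (induction V qs rule: ordered.induct) auto

lemma own_None_U: "x \<in> U \<Longrightarrow> own x = None"
  using own_Some by (cases "own x") auto

context
  fixes M :: "'u struct"
begin

text \<open>What the position still leaves open about \<open>x\<close>: the tree of choices for the remaining
  variables local to \<open>x\<close>, with the sets of true atoms of \<open>Atx x\<close> as leaves.\<close>

fun state :: "quants \<Rightarrow> (nat \<Rightarrow> 'u) \<Rightarrow> nat \<Rightarrow> nat" where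
  "state [] e x = set_encode (atom_encode ` {a \<in> Atx x. atom_holds M e a})"
| "state ((b, y) # qs) e x =
     (if own y = Some x then set_encode ((\<lambda>d. state qs (e(y := d)) x) ` domain M)
      else state qs e x)"

text \<open>Locals of \<open>x\<close> that are still in the prefix are overwritten before a leaf is
  reached, so their present values do not matter.\<close>

lemma state_cong:
  "(\<And>v. v \<in> vars (Atx x) \<Longrightarrow> \<not> (own v = Some x \<and> (False, v) \<in> set qs) \<Longrightarrow> e v = e' v) \<Longrightarrow>
   (\<And>b v. (b, v) \<in> set qs \<Longrightarrow> b \<longleftrightarrow> v \<in> U) \<Longrightarrow> state qs e x = state qs e' x"
proof (induction qs arbitrary: e e')
  case Nil
  have "atom_holds M e a = atom_holds M e' a" if "a \<in> Atx x" for a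
    by (rule atom_holds_cong) (use Nil that in \<open>auto simp: vars_def\<close>)
  then have "{a \<in> Atx x. atom_holds M e a} = {a \<in> Atx x. atom_holds M e' a}" by blast
  then show ?case by simp
next
  case (Cons by' qs)
  obtain b y where y: "by' = (b, y)" by force
  have eqU: "\<And>b v. (b, v) \<in> set qs \<Longrightarrow> b \<longleftrightarrow> v \<in> U" using Cons.prems(2) by simp
  show ?case
  proof (cases "own y = Some x")
    case True
    then have b: "\<not> b" using own_Some Cons.prems(2) y by auto
    have "state qs (e(y := d)) x = state qs (e'(y := d)) x" for d
      by (rule Cons.IH[OF _ eqU]) (use Cons.prems(1) y b in auto)
    then show ?thesis using y True by simp
  next
    case False
    have "state qs e x = state qs e' x"
      by (rule Cons.IH[OF _ eqU]) (use Cons.prems(1) y False in auto)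
    then show ?thesis using y False by simp
  qed
qed

lemma state_upd:
  "y \<notin> vars (Atx x) \<Longrightarrow> (\<And>b v. (b, v) \<in> set qs \<Longrightarrow> b \<longleftrightarrow> v \<in> U) \<Longrightarrow>
   state qs (e(y := d)) x = state qs e x"
  by (rule state_cong) auto

text \<open>The domain may be infinite, yet the states reached by one more move all lie below the
  previous level of the tower. For \<open>x\<close> in \<open>U\<close> the function
  \<open>set_encode\<close> is thus applied to finite sets, on which it is injective.\<close>

lemma state_less_tower: "x \<in> U \<Longrightarrow> state qs e x < tower q (length qs)"
proof (induction qs arbitrary: e)
  case Nil
  have "atom_encode ` {a \<in> Atx x. atom_holds M e a} \<subseteq> {..<Suc q}"
    using code_le Nil by (force simp: less_Suc_eq_le)
  then show ?case using set_encode_less by (simp only: state.simps list.size tower_simps)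
next
  case (Cons by' qs)
  obtain b y where y: "by' = (b, y)" by force
  have "(\<lambda>d. state qs (e(y := d)) x) ` domain M \<subseteq> {..<tower q (length qs)}"
    using Cons by auto
  from set_encode_less[OF this]
  have "set_encode ((\<lambda>d. state qs (e(y := d)) x) ` domain M) < tower q (Suc (length qs))"
    by (simp only: tower_simps)
  moreover have "state qs e x < tower q (Suc (length qs))"
    using Cons.IH[OF Cons.prems, of e] tower_mono[of "length qs" "Suc (length qs)" q] by simp
  ultimately show ?case using y by simp
qed

text \<open>The equivalence of positions under which the existential player can keep to one plan.
  Values of universal and local variables may differ as long as they lead to the same
  states.\<close>

definition similar :: "nat set \<Rightarrow> quants \<Rightarrow> (nat \<Rightarrow> 'u) \<Rightarrow> (nat \<Rightarrow> 'u) \<Rightarrow> bool" where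
  "similar V qs e e' \<longleftrightarrow>
     (\<forall>y\<in>V - U. own y = None \<longrightarrow> e y = e' y) \<and> (\<forall>x\<in>V \<inter> U. state qs e x = state qs e' x)"

definition global_dom :: "'u set \<Rightarrow> nat \<Rightarrow> 'u set" where
  "global_dom K v = (if v \<notin> U \<and> own v = None then K else domain M)"

text \<open>A single \<open>K\<close> has to serve all positions similar to \<open>e\<close>; this
  uniformity carries the induction. At a universal variable one move per state is representative, so
  at most \<open>S\<close> sets are united. At a global variable the same value is reused in every
  similar position, and at a local variable equal states supply the answering move.\<close>

lemma finitely_many_globals:
  assumes "ordered V qs" "game (\<lambda>_. domain M) W qs e"
    and "\<And>e e'. similar (V \<union> snd ` set qs) [] e e' \<Longrightarrow> W e \<Longrightarrow> W e'"
    and "tower q (length qs) \<le> S" "S > 0"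
  shows "\<exists>K. finite K \<and> K \<subseteq> domain M \<and> card K \<le> Suc S ^ length qs \<and>
    (\<forall>e'. similar V qs e e' \<longrightarrow> game (global_dom K) W qs e')"
  using assms(1-4)
proof (induction qs arbitrary: V e)
  case Nil
  then show ?case by (intro exI[of _ "{}"]) auto
next
  case (Cons bv qs)
  obtain b v where bv: "bv = (b, v)" by force
  have qsU: "b \<longleftrightarrow> v \<in> U" if "(b, v) \<in> set qs" for b v
    using ordered_iff[OF Cons.prems(1)] that by simp
  have ord: "ordered (insert v V) qs" using Cons.prems(1) bv by (cases b) auto
  have Vend: "insert v V \<union> snd ` set qs = V \<union> snd ` set (bv # qs)" using bv by auto
  have S: "tower q (length qs) \<le> S"
    using Cons.prems(4) tower_mono[of "length qs" "length (bv # qs)" q] by simp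
  have IH: "\<exists>K. finite K \<and> K \<subseteq> domain M \<and> card K \<le> Suc S ^ length qs \<and>
    (\<forall>e'. similar (insert v V) qs e e' \<longrightarrow> game (global_dom K) W qs e')"
    if "game (\<lambda>_. domain M) W qs e" for e
    by (rule Cons.IH[OF ord that _ S]) (use Cons.prems(3) Vend in auto)
  have mono: "game (global_dom K') W qs e'"
    if "game (global_dom K) W qs e'" "K \<subseteq> K'" for K K' e'
    by (rule game_mono[OF that(1)]) (use that(2) qsU in \<open>auto simp: global_dom_def\<close>)
  show ?case
  proof (cases b)
    case True
    then have vU: "v \<in> U" and vV: "v \<notin> V" using Cons.prems(1) bv by auto
    have "\<forall>d\<in>domain M. \<exists>K. finite K \<and> K \<subseteq> domain M \<and> card K \<le> Suc S ^ length qs \<and>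
      (\<forall>e'. similar (insert v V) qs (e(v := d)) e' \<longrightarrow> game (global_dom K) W qs e')"
    proof
      fix d assume "d \<in> domain M"
      then have "game (\<lambda>_. domain M) W qs (e(v := d))" using Cons.prems(2) bv True by simp
      from IH[OF this] show "\<exists>K. finite K \<and> K \<subseteq> domain M \<and> card K \<le> Suc S ^ length qs \<and>
        (\<forall>e'. similar (insert v V) qs (e(v := d)) e' \<longrightarrow> game (global_dom K) W qs e')" .
    qed
    from bchoice[OF this] obtain G where "\<forall>d\<in>domain M. finite (G d) \<and>
      G d \<subseteq> domain M \<and> card (G d) \<le> Suc S ^ length qs \<and>
      (\<forall>e'. similar (insert v V) qs (e(v := d)) e' \<longrightarrow> game (global_dom (G d)) W qs e')" ..
    note G = bspec[OF this]
    define st where "st d = state qs (e(v := d)) v" for d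
    define rep where "rep s = (SOME d. d \<in> domain M \<and> st d = s)" for s
    have rep: "rep (st d) \<in> domain M \<and> st (rep (st d)) = st d" if "d \<in> domain M" for d
      unfolding rep_def by (rule someI[of _ d]) (use that in auto)
    define K where "K = (\<Union>s\<in>st ` domain M. G (rep s))"
    have stS: "st ` domain M \<subseteq> {..<S}"
      using state_less_tower[OF vU, of qs] S by (auto simp: st_def intro: less_le_trans)
    then have fin: "finite (st ` domain M)" and cS: "card (st ` domain M) \<le> S"
      using finite_subset[OF stS] card_mono[OF _ stS] by auto
    have "card K \<le> S * Suc S ^ length qs"
      unfolding K_def by (rule card_UN_bounded[OF fin cS]) (use G rep in auto)
    moreover have "finite K" "K \<subseteq> domain M" using fin G rep unfolding K_def by blast+
    moreover have "game (global_dom K) W qs (e'(v := d))"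
      if sim: "similar V (bv # qs) e e'" and d: "d \<in> domain M" for e' d
    proof -
      let ?d = "rep (st d)"
      have own_v: "own v = None" by (rule own_None_U[OF vU])
      have old: "state qs (e(v := ?d)) x = state qs (e'(v := d)) x" if x: "x \<in> V \<inter> U" for x
      proof -
        have "v \<notin> vars (Atx x)" using Atx_U[of x] x vU vV by auto
        moreover have "state qs e x = state qs e' x"
          using sim x bv own_v by (auto simp: similar_def)
        ultimately show ?thesis using qsU by (simp add: state_upd)
      qed
      \<comment> \<open>Right after its own quantifier the state of \<open>v\<close> depends on the
        value of \<open>v\<close> and on globals already chosen, where \<open>e\<close> and
        \<open>e'\<close> agree; the locals of \<open>v\<close> all lie ahead.\<close>
      have "state qs (e(v := d)) v = state qs (e'(v := d)) v"
      proof (rule state_cong[OF _ qsU])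
        fix u assume u: "u \<in> vars (Atx v)" "\<not> (own u = Some v \<and> (False, u) \<in> set qs)"
        show "(e(v := d)) u = (e'(v := d)) u"
        proof (cases "u = v")
          case False
          then have uU: "u \<notin> U" using u(1) Atx_U[OF vU] by auto
          have "case own u of None \<Rightarrow> u \<in> V | Some x' \<Rightarrow> (False, u) \<in> set qs"
            using Cons.prems(1) bv True u(1) uU by simp
          then have "own u = None" "u \<in> V"
            using u own_unique[OF _ vU u(1)] by (auto split: option.splits)
          then show ?thesis using sim uU False by (auto simp: similar_def)
        qed simp
      qed
      then have "st d = state qs (e'(v := d)) v" by (simp add: st_def)
      then have "similar (insert v V) qs (e(v := ?d)) (e'(v := d))"
        using old rep[OF d] sim vU vV by (auto simp: similar_def st_def)
      then have "game (global_dom (G ?d)) W qs (e'(v := d))" using G rep[OF d] by blast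
      then show ?thesis by (rule mono) (use d in \<open>auto simp: K_def\<close>)
    qed
    moreover have "global_dom K v = domain M" using vU by (simp add: global_dom_def)
    ultimately show ?thesis
      using bv True by (intro exI[of _ K]) (simp del: fun_upd_apply)
  next
    case False
    then have vU: "v \<notin> U" and vV: "v \<notin> V" using Cons.prems(1) bv by auto
    obtain d where d: "d \<in> domain M" "game (\<lambda>_. domain M) W qs (e(v := d))"
      using Cons.prems(2) bv False by auto
    from IH[OF d(2)] obtain K where K: "finite K" "K \<subseteq> domain M" "card K \<le> Suc S ^ length qs"
      "\<And>e'. similar (insert v V) qs (e(v := d)) e' \<Longrightarrow> game (global_dom K) W qs e'" by blast
    have card: "card (insert d K) \<le> Suc S ^ length (bv # qs)"
    proof -
      have "1 \<le> S * Suc S ^ length qs" using \<open>S > 0\<close> by (simp add: Suc_le_eq)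
      moreover have "card (insert d K) \<le> Suc (card K)" using K(1) by (simp add: card_insert_if)
      ultimately have "card (insert d K) \<le> Suc S ^ length qs + S * Suc S ^ length qs"
        using K(3) by linarith
      then show ?thesis by simp
    qed
    have "\<exists>d'\<in>global_dom (insert d K) v. game (global_dom (insert d K)) W qs (e'(v := d'))"
      if sim: "similar V (bv # qs) e e'" for e'
    proof (cases "own v")
      case None
      \<comment> \<open>By (c.1) a global variable occurs in no atom of an earlier universal
        variable, so its value changes no state and \<open>d\<close> can be reused for
        \<open>e'\<close>.\<close>
      have "state qs (e(v := d)) x = state qs (e'(v := d)) x" if x: "x \<in> V \<inter> U" for x
      proof -
        have "v \<notin> vars (Atx x)" using Cons.prems(1) bv False None x by auto
        moreover have "state qs e x = state qs e' x"
          using sim x bv None by (auto simp: similar_def)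
        ultimately show ?thesis using qsU by (simp add: state_upd)
      qed
      then have "similar (insert v V) qs (e(v := d)) (e'(v := d))"
        using sim vU by (auto simp: similar_def)
      from mono[OF K(4)[OF this]] show ?thesis
        using None vU by (intro bexI[of _ d]) (auto simp: global_dom_def)
    next
      case (Some x)
      have x: "x \<in> V \<inter> U" using Cons.prems(1) bv False Some own_Some by auto
      have fin: "finite ((\<lambda>d. state qs (f(v := d)) x) ` domain M)" for f
        by (rule finite_subset[of _ "{..<tower q (length qs)}"])
          (use state_less_tower x in auto)
      \<comment> \<open>Before a local move the state of its owner codes the set of states the move
        can lead to; from equal sets the move \<open>d'\<close> that matches \<open>d\<close> is
        obtained.\<close>
      have "state (bv # qs) e x = state (bv # qs) e' x" using sim x by (simp add: similar_def)
      then have "(\<lambda>d. state qs (e(v := d)) x) ` domain M = (\<lambda>d. state qs (e'(v := d)) x) ` domain M"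
        using bv Some set_encode_eq[OF fin fin] by simp
      then obtain d' where d': "d' \<in> domain M"
        "state qs (e(v := d)) x = state qs (e'(v := d')) x" using d(1) by blast
      have "state qs (e(v := d)) x' = state qs (e'(v := d')) x'" if x': "x' \<in> V \<inter> U" for x'
      proof (cases "x' = x")
        case False
        then have "v \<notin> vars (Atx x')" using own_unique[OF Some] x' by auto
        moreover have "state (bv # qs) e x' = state (bv # qs) e' x'"
          using sim x' unfolding similar_def by blast
        then have "state qs e x' = state qs e' x'" using bv Some False by simp
        ultimately show ?thesis using qsU by (simp add: state_upd)
      qed (use d' in simp)
      then have "similar (insert v V) qs (e(v := d)) (e'(v := d'))"
        using sim vU Some by (auto simp: similar_def)
      from mono[OF K(4)[OF this]] show ?thesis
        using Some d' by (intro bexI[of _ d']) (auto simp: global_dom_def)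
    qed
    then show ?thesis
      using bv False K d card by (intro exI[of _ "insert d K"]) (simp del: fun_upd_apply)
  qed
qed

end

end

section \<open>The finite copy\<close>

lemma Pred_encode_le:
  "atom_encode (Pred P ts) \<le> q \<Longrightarrow> P \<le> q \<and> length ts \<le> q \<and> (\<forall>s\<in>set ts. tm_encode s \<le> q)"
proof (intro conjI ballI)
  assume le: "atom_encode (Pred P ts) \<le> q"
  have 1: "prod_encode (P, list_encode (map tm_encode ts)) \<le> q"
    using le le_prod_encode_2 order_trans by fastforce
  then show "P \<le> q" using le_prod_encode_1 order_trans by blast
  have "list_encode (map tm_encode ts) \<le> q" using 1 le_prod_encode_2 order_trans by blast
  then show "length ts \<le> q" using length_le_list_encode[of "map tm_encode ts"] by simp
  show "tm_encode s \<le> q" if "s \<in> set ts" for s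
    using tm_encode_args_le[OF that, of P] le by linarith
qed

text \<open>An element \<open>(i, a, w)\<close> of the copy has level \<open>i\<close> and imitates \<open>w\<close> as a witness for the
  representative \<open>a\<close>.  The witnesses of \<open>u\<close> lie one level, modulo 3, above \<open>u\<close> and carry the
  representative of \<open>u\<close>, so that a pair of elements outside \<open>K\<close> never shows up in two conflicting
  roles.\<close>

locale finite_copy =
  fixes M :: "'u struct" and K R F :: "'u set" and r :: "'u \<Rightarrow> 'u" and q :: nat
  assumes K: "K \<subseteq> domain M" "finite K"
    and cst_K: "\<And>c. c \<le> q \<Longrightarrow> cst M c \<in> K"
    and R: "R = r ` domain M" "finite R"
    and F: "F \<subseteq> domain M" "finite F"
    and r_K: "\<And>d. d \<in> K \<Longrightarrow> r d = d"
    and r_not_K: "\<And>d. d \<in> domain M \<Longrightarrow> d \<notin> K \<Longrightarrow> r d \<in> domain M - K"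
    and r_type: "\<And>d P ts. d \<in> domain M \<Longrightarrow> d \<notin> K \<Longrightarrow> P \<le> q \<Longrightarrow> length ts \<le> q \<Longrightarrow>
      set ts \<subseteq> insert None (Some ` K) \<Longrightarrow>
      prd M P (map (case_option d id) ts) = prd M P (map (case_option (r d) id) ts)"
begin

type_synonym 'b elem = "'b + nat \<times> 'b \<times> 'b"

fun orig :: "'u elem \<Rightarrow> 'u" where
  "orig (Inl k) = k"
| "orig (Inr (i, a, w)) = w"

fun level :: "'u elem \<Rightarrow> nat" where
  "level (Inl k) = 0"
| "level (Inr (i, a, w)) = i"

definition rep :: "'u elem \<Rightarrow> 'u" where
  "rep u = r (orig u)"

text \<open>A witness records only the level and the representative of \<open>u\<close>, so elements
  that agree in both share their witnesses; this keeps the copy finite. Elements of \<open>K\<close>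
  count as level 0.\<close>

definition child :: "'u elem \<Rightarrow> 'u \<Rightarrow> 'u elem" where
  "child u d = Inr ((level u + 1) mod 3, rep u, d)"

text \<open>Carries a play in \<open>M\<close> with universal value \<open>rep u\<close> to a play
  in the copy with universal value \<open>u\<close>.\<close>

definition place :: "'u elem \<Rightarrow> 'u \<Rightarrow> 'u elem" where
  "place u d = (if d \<in> K then Inl d else if d = rep u then u else child u d)"

text \<open>An element has two roles: next to its own witnesses it stands for its representative,
  otherwise for the element it was created as. The tuple decides by containing such a witness or
  not.\<close>

definition proj :: "'u elem list \<Rightarrow> 'u elem \<Rightarrow> 'u" where
  "proj us u = (if \<exists>d. child u d \<in> set us then rep u else orig u)"

text \<open>A constant with value outside \<open>K\<close> has index above \<open>q\<close> and
  occurs in no atom of code up to \<open>q\<close>; the default \<open>cst M 0\<close> keeps its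
  interpretation in the domain.\<close>

definition copy :: "'u elem struct" where
  "copy = \<lparr>domain = Inl ` K \<union> Inr ` ({..<3} \<times> R \<times> (F - K)),
     cst = (\<lambda>c. Inl (if cst M c \<in> K then cst M c else cst M 0)),
     prd = (\<lambda>P us. prd M P (map (proj us) us))\<rparr>"

lemma is_struct_copy: "is_struct copy"
  using cst_K[of 0] by (auto simp: is_struct_def copy_def)

lemma finite_copy: "finite (domain copy)"
  using K(2) R(2) F(2) by (simp add: copy_def)

lemma card_copy: "card (domain copy) \<le> card K + 3 * (card R * card F)"
proof -
  have "card (domain copy) \<le>
      card (Inl ` K :: 'u elem set) + card (Inr ` ({..<3} \<times> R \<times> (F - K)) :: 'u elem set)"
    unfolding copy_def struct.select_convs by (rule card_Un_le)
  also have "card (Inl ` K :: 'u elem set) = card K" by (simp add: card_image)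
  also have "card (Inr ` ({..<3} \<times> R \<times> (F - K)) :: 'u elem set) = 3 * (card R * card (F - K))"
    by (simp add: card_image card_cartesian_product)
  also have "\<dots> \<le> 3 * (card R * card F)"
    using F card_mono[of F "F - K"] by simp
  finally show ?thesis by simp
qed

lemma domain_cases:
  assumes "u \<in> domain copy"
  obtains (known) k where "u = Inl k" "k \<in> K" "rep u = k"
  | (new) i a w where "u = Inr (i, a, w)" "i < 3" "a \<in> R" "w \<in> F" "w \<notin> K" "rep u = r w"
      "rep u \<notin> K"
  using assms r_K r_not_K F by (auto simp: copy_def rep_def subset_iff)

lemma rep_in_R:
  assumes "u \<in> domain copy"
  shows "rep u \<in> R"
proof -
  have "orig u \<in> domain M" using assms K(1) F(1) by (auto simp: copy_def)
  then show ?thesis by (simp add: rep_def R(1))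
qed

lemma place_rep: "u \<in> domain copy \<Longrightarrow> place u (rep u) = u"
  by (erule domain_cases) (auto simp: place_def)

lemma place_in_copy:
  assumes "u \<in> domain copy" "d \<in> F \<union> K"
  shows "place u d \<in> domain copy"
  using assms rep_in_R[OF assms(1)] by (auto simp: place_def child_def copy_def)

lemma child_neq: "u \<in> domain copy \<Longrightarrow> child u d \<noteq> u"
  by (erule domain_cases) (auto simp: child_def mod_Suc)

text \<open>The reason for three levels: with two, a witness of a witness of \<open>u\<close> could
  be \<open>u\<close> itself.\<close>

lemma grandchild_neq: "u \<in> domain copy \<Longrightarrow> child (child u d) d' \<noteq> u"
  by (erule domain_cases) (auto simp: child_def mod_Suc)

lemma great_child_neq: "child (child u d) d' \<noteq> child u d''"
  by (auto simp: child_def mod_Suc)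

lemma place_inj:
  assumes "u \<in> domain copy" "place u d = place u d'"
  shows "d = d'"
  using assms(1)
proof (cases rule: domain_cases)
  case known
  then show ?thesis using assms(2) by (auto simp: place_def child_def split: if_splits)
next
  case new
  then show ?thesis
    using assms(2) child_neq[OF assms(1)] by (auto simp: place_def child_def split: if_splits)
qed

text \<open>As soon as a witness of \<open>u\<close> occurs in the tuple, \<open>proj\<close> undoes
  \<open>place u\<close>. Otherwise the tuple consists of \<open>u\<close> and elements of
  \<open>K\<close>, and \<open>u\<close> is read as its original instead of its representative;
  these two have the same one-element type over \<open>K\<close>.\<close>

lemma prd_copy:
  assumes u: "u \<in> domain copy" and P: "P \<le> q" and len: "length ds \<le> q"
  shows "prd copy P (map (place u) ds) = prd M P ds"
proof -
  define us where "us = map (place u) ds"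
  have old: "proj us (Inl k) = k" if "k \<in> K" for k
    using r_K[OF that] by (simp add: proj_def rep_def)
  have mem: "v \<in> Inl ` K \<union> {u} \<union> range (child u)" if "v \<in> set us" for v
    using that by (auto simp: us_def place_def)
  \<comment> \<open>No tuple around \<open>u\<close> contains a witness of a witness of
    \<open>u\<close>, so the witnesses of \<open>u\<close> are read as their originals.\<close>
  have "child (child u d) d' \<notin> set us" for d d'
    using mem[of "child (child u d) d'"] great_child_neq[of u d d'] grandchild_neq[OF u, of d d']
    by (auto simp: child_def)
  then have new: "proj us (child u d) = d" for d
    unfolding proj_def by (simp add: child_def)
  have "prd M P (map (proj us) us) = prd M P ds"
  proof (cases "\<exists>d\<in>set ds. d \<notin> K \<and> d \<noteq> rep u")
    case True
    then obtain d where "d \<in> set ds" "place u d = child u d" by (auto simp: place_def)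
    then have "child u d \<in> set us" by (metis us_def image_eqI set_map)
    then have "proj us u = rep u" by (auto simp: proj_def)
    then have "proj us (place u d) = d" for d using old new by (auto simp: place_def)
    then have "map (proj us) us = ds" by (simp add: us_def comp_def)
    then show ?thesis by simp
  next
    case False
    from u show ?thesis
    proof (cases rule: domain_cases)
      case (known k)
      then have "proj us (place u d) = d" if "d \<in> set ds" for d
        using False old that by (auto simp: place_def)
      then have "map (proj us) us = ds" by (simp add: us_def comp_def map_idI)
      then show ?thesis by simp
    next
      case (new i a w)
      have "child u d \<notin> set us" for d
        using False child_neq[OF u, of d] by (auto simp: us_def place_def child_def)
      then have pu: "proj us u = w" using new by (simp add: proj_def)
      \<comment> \<open>\<open>None\<close> marks the places of \<open>rep u\<close>: filling in
        \<open>w\<close> gives the tuple as read by \<open>proj\<close>, filling in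
        \<open>r w\<close> gives \<open>ds\<close>.\<close>
      define ts where "ts = map (\<lambda>d. if d \<in> K then Some d else None) ds"
      have "map (proj us) us = map (case_option w id) ts"
        using False old pu by (auto simp: us_def ts_def place_def)
      moreover have "map (case_option (r w) id) ts = ds"
        using False new by (auto simp: ts_def intro!: map_idI)
      moreover have "prd M P (map (case_option w id) ts) = prd M P (map (case_option (r w) id) ts)"
        by (rule r_type) (use new F P len in \<open>auto simp: ts_def\<close>)
      ultimately show ?thesis by simp
    qed
  qed
  then show ?thesis by (simp add: copy_def us_def)
qed

lemma atom_holds_copy:
  assumes u: "u \<in> domain copy" and a: "atom_encode a \<le> q"
    and e: "\<And>v. v \<in> atom_vars a \<Longrightarrow> e' v = place u (e v)"
  shows "atom_holds copy e' a = atom_holds M e a"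
proof -
  have tv: "tm_val copy e' s = place u (tm_val M e s)"
    if "tm_encode s \<le> q" "\<And>v. v \<in> tm_vars s \<Longrightarrow> e' v = place u (e v)" for s
  proof (cases s)
    case (Const c)
    then have "c \<le> q" using that(1) le_prod_encode_2[of c 1] by simp
    then show ?thesis using Const cst_K by (simp add: copy_def place_def)
  qed (use that in simp)
  show ?thesis
  proof (cases a)
    case (Pred P ts)
    note le = Pred_encode_le[OF a[unfolded Pred]]
    have "map (tm_val copy e') ts = map (place u) (map (tm_val M e) ts)"
      using le e Pred by (auto intro!: tv)
    then show ?thesis
      using prd_copy[OF u, of P "map (tm_val M e) ts"] le unfolding Pred atom_holds.simps
      by (simp only: length_map)
  next
    case (Eq s t)
    have "tm_encode s \<le> q" "tm_encode t \<le> q"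
      using a tm_encode_Eq_le(1)[of s t] tm_encode_Eq_le(2)[of t s] unfolding Eq by linarith+
    then have "tm_val copy e' s = place u (tm_val M e s)" "tm_val copy e' t = place u (tm_val M e t)"
      using e Eq by (auto intro!: tv)
    then show ?thesis using Eq place_inj[OF u] by auto
  qed
qed

end

locale ackermann_copy = ackermann_partition U At0 Atx own q + finite_copy M K R F r q
  for U At0 Atx own and M :: "'u struct" and K R F r q
begin

text \<open>Invariant of the strategy transfer: a universal move \<open>u\<close> in the copy is
  treated as the move \<open>rep u\<close> in \<open>M\<close>, and local answers are placed around
  the value of their owner.\<close>

definition matched :: "nat set \<Rightarrow> (nat \<Rightarrow> 'u) \<Rightarrow> (nat \<Rightarrow> 'u elem) \<Rightarrow> bool" where
  "matched V e e' \<longleftrightarrow>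
     (\<forall>x\<in>V \<inter> U. e' x \<in> domain copy \<and> e x = rep (e' x)) \<and>
     (\<forall>y\<in>V - U. case own y of None \<Rightarrow> e y \<in> K \<and> e' y = Inl (e y)
        | Some x \<Rightarrow> x \<in> V \<and> e' y = place (e' x) (e y))"

text \<open>An atom has at most one universal variable \<open>x\<close>, so all its values can be
  regarded as placed around \<open>e' x\<close>; elements of \<open>K\<close> go to the same place
  around every centre.\<close>

lemma matched_atoms:
  assumes m: "matched V e e'" and U: "U \<subseteq> V"
    and V: "vars (At0 \<union> (\<Union>x\<in>U. Atx x)) \<subseteq> V"
    and a: "a \<in> At0 \<union> (\<Union>x\<in>U. Atx x)"
  shows "atom_holds copy e' a = atom_holds M e a"
proof -
  have aq: "atom_encode a \<le> q" using code_le a by blast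
  have aV: "v \<in> V" if "v \<in> atom_vars a" for v using V a that by (force simp: vars_def)
  show ?thesis
  proof (cases "a \<in> At0")
    case True
    \<comment> \<open>Atoms of \<open>At0\<close> take their variables' values from
      \<open>K\<close>, so any element can be the centre; a constant provides one.\<close>
    have u: "Inl (cst M 0) \<in> domain copy" using cst_K by (auto simp: copy_def)
    show ?thesis
    proof (rule atom_holds_copy[OF u aq])
      fix v assume v: "v \<in> atom_vars a"
      then have v0: "v \<in> vars At0" using True by (auto simp: vars_def)
      then have "v \<notin> U" "own v = None"
        using At0_U own_Some[of v] by (blast, cases "own v") auto
      moreover have "case own v of None \<Rightarrow> e v \<in> K \<and> e' v = Inl (e v)
          | Some x \<Rightarrow> x \<in> V \<and> e' v = place (e' x) (e v)"
        using m aV[OF v] \<open>v \<notin> U\<close> unfolding matched_def by blast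
      ultimately have "e v \<in> K \<and> e' v = Inl (e v)" by simp
      then show "e' v = place (Inl (cst M 0)) (e v)" by (simp add: place_def)
    qed
  next
    case False
    then obtain x where x: "x \<in> U" "a \<in> Atx x" using a by blast
    then have u: "e' x \<in> domain copy" "e x = rep (e' x)" using m U by (auto simp: matched_def)
    show ?thesis
    proof (rule atom_holds_copy[OF u(1) aq])
      fix v assume v: "v \<in> atom_vars a"
      then have vx: "v \<in> vars (Atx x)" using x by (auto simp: vars_def)
      show "e' v = place (e' x) (e v)"
      proof (cases "v \<in> U")
        case True
        then have "v = x" using vx Atx_U[OF x(1)] by auto
        then show ?thesis using u place_rep by simp
      next
        case False
        then have "case own v of None \<Rightarrow> e v \<in> K \<and> e' v = Inl (e v)
            | Some x \<Rightarrow> x \<in> V \<and> e' v = place (e' x) (e v)"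
          using m aV[OF v] unfolding matched_def by blast
        then show ?thesis
          using own_unique[OF _ x(1) vx] by (cases "own v") (auto simp: place_def)
      qed
    qed
  qed
qed

text \<open>The existential player follows a strategy that wins in \<open>M\<close> against
  representatives: \<open>rep\<close> translates the universal moves and \<open>place\<close> the
  local answers. Taking all answers from \<open>F\<close> keeps them inside the domain of the
  copy.\<close>

lemma game_copy:
  assumes "ordered V qs" "matched V e e'"
    and "game (\<lambda>v. if v \<in> U then R else if own v = None then K \<inter> F else F) W qs e"
    and "\<And>e e'. matched (V \<union> snd ` set qs) e e' \<Longrightarrow> W e \<Longrightarrow> W' e'"
  shows "game (\<lambda>_. domain copy) W' qs e'"
  using assms
proof (induction qs arbitrary: V e e')
  case Nil
  then show ?case by simp
next
  case (Cons bv qs)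
  obtain b v where bv: "bv = (b, v)" by force
  have ord: "ordered (insert v V) qs" using Cons.prems(1) bv by (cases b) auto
  have vV: "v \<notin> V" using Cons.prems(1) bv by (cases b) auto
  have Vend: "insert v V \<union> snd ` set qs = V \<union> snd ` set (bv # qs)" using bv by auto
  note IH = Cons.IH[OF ord _ _ Cons.prems(4)[folded Vend]]
  have keep: "matched (insert v V) (e(v := d)) (e'(v := d'))"
    if new: "v \<in> U \<Longrightarrow> d' \<in> domain copy \<and> d = rep d'"
      "v \<notin> U \<Longrightarrow> own v = None \<Longrightarrow> d \<in> K \<and> d' = Inl d"
      "\<And>x. v \<notin> U \<Longrightarrow> own v = Some x \<Longrightarrow> x \<in> V \<and> d' = place (e' x) d" for d d'
  proof -
    have "case own y of None \<Rightarrow> (e(v := d)) y \<in> K \<and> (e'(v := d')) y = Inl ((e(v := d)) y)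
        | Some x \<Rightarrow> x \<in> insert v V \<and> (e'(v := d')) y = place ((e'(v := d')) x) ((e(v := d)) y)"
      if y: "y \<in> insert v V - U" for y
    proof (cases "y = v")
      case True
      then show ?thesis using new(2,3) y vV by (cases "own v") auto
    next
      case False
      then have "case own y of None \<Rightarrow> e y \<in> K \<and> e' y = Inl (e y)
          | Some x \<Rightarrow> x \<in> V \<and> e' y = place (e' x) (e y)"
        using Cons.prems(2) y by (auto simp: matched_def)
      then show ?thesis using False vV by (cases "own y") auto
    qed
    moreover have "(e'(v := d')) x \<in> domain copy \<and> (e(v := d)) x = rep ((e'(v := d')) x)"
      if "x \<in> insert v V \<inter> U" for x
      using Cons.prems(2) that new(1)
      by (auto simp: matched_def)
    ultimately show ?thesis unfolding matched_def by blast
  qed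
  show ?case
  proof (cases b)
    case True
    then have vU: "v \<in> U" using Cons.prems(1) bv by simp
    have "game (\<lambda>_. domain copy) W' qs (e'(v := d'))" if d': "d' \<in> domain copy" for d'
    proof (rule IH[OF keep])
      show "game (\<lambda>v. if v \<in> U then R else if own v = None then K \<inter> F else F) W qs (e(v := rep d'))"
        using Cons.prems(3) bv True vU rep_in_R[OF d'] by simp
    qed (use vU d' in auto)
    then show ?thesis using bv True by simp
  next
    case False
    then have vU: "v \<notin> U" using Cons.prems(1) bv by simp
    obtain d where d: "d \<in> F" "own v = None \<Longrightarrow> d \<in> K"
      "game (\<lambda>v. if v \<in> U then R else if own v = None then K \<inter> F else F) W qs (e(v := d))"
      using Cons.prems(3) bv False vU by (auto split: if_splits)
    show ?thesis
    proof (cases "own v")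
      case None
      have "game (\<lambda>_. domain copy) W' qs (e'(v := Inl d))"
        by (rule IH[OF keep d(3)]) (use None vU d in auto)
      moreover have "Inl d \<in> domain copy" using d None by (simp add: copy_def)
      ultimately show ?thesis using bv False by auto
    next
      case (Some x)
      then have x: "x \<in> V" using Cons.prems(1) bv False by simp
      have "game (\<lambda>_. domain copy) W' qs (e'(v := place (e' x) d))"
        by (rule IH[OF keep d(3)]) (use Some vU d x in auto)
      moreover have "place (e' x) d \<in> domain copy"
        using Cons.prems(2) x own_Some[OF Some] d by (intro place_in_copy) (auto simp: matched_def)
      ultimately show ?thesis using bv False by auto
    qed
  qed
qed

end

section \<open>Small models and decidability\<close>

text \<open>With no quantifier left, a state codes the set of true atoms of \<open>Atx x\<close>,
  which can be recovered because it is finite and the coding is injective. Atoms of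
  \<open>At0\<close> see global values only.\<close>

lemma (in ackermann_partition) similar_atoms:
  assumes sim: "similar M V [] e e'" and U: "U \<subseteq> V"
    and V: "vars (At0 \<union> (\<Union>x\<in>U. Atx x)) \<subseteq> V"
    and a: "a \<in> At0 \<union> (\<Union>x\<in>U. Atx x)"
  shows "atom_holds M e a = atom_holds M e' a"
proof (cases "a \<in> At0")
  case True
  show ?thesis
  proof (rule atom_holds_cong)
    fix v assume v: "v \<in> atom_vars a"
    then have v0: "v \<in> vars At0" using True by (auto simp: vars_def)
    then have "v \<notin> U" "own v = None" "v \<in> V"
      using At0_U own_Some[of v] V by (blast, cases "own v", auto simp: vars_def)
    then show "e v = e' v" using sim by (auto simp: similar_def)
  qed
next
  case False
  then obtain x where x: "x \<in> U" "a \<in> Atx x" using a by blast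
  have "atom_encode ` {a \<in> Atx x. P a} \<subseteq> {..q}" for P using code_le x by force
  then have fin: "finite (atom_encode ` {a \<in> Atx x. P a})" for P
    by (rule finite_subset) simp
  have "state M [] e x = state M [] e' x" using sim x U by (auto simp: similar_def)
  then have "{a \<in> Atx x. atom_holds M e a} = {a \<in> Atx x. atom_holds M e' a}"
    by (simp add: set_encode_eq[OF fin fin] inj_image_eq_iff[OF inj_atom_encode])
  then show ?thesis using x by blast
qed

text \<open>In \<open>ts\<close>, \<open>None\<close> is the place of the element and
  \<open>Some\<close> holds a parameter from \<open>K\<close>. There are at most
  \<open>Suc q * Suc k ^ q\<close> such lists and \<open>Suc q\<close> predicate names, and a type
  is a set of pairs of a name and a list. Equality with elements of \<open>K\<close> is respected
  since representatives of outside elements stay outside \<open>K\<close>.\<close>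

lemma type_representatives:
  fixes M :: "'u struct"
  assumes "finite K" "K \<subseteq> domain M" "card K \<le> k"
  shows "\<exists>r. (\<forall>d\<in>K. r d = d) \<and> (\<forall>d\<in>domain M - K. r d \<in> domain M - K) \<and>
    (\<forall>d\<in>domain M - K. \<forall>P ts. P \<le> q \<and> length ts \<le> q \<and> set ts \<subseteq> insert None (Some ` K) \<longrightarrow>
       prd M P (map (case_option d id) ts) = prd M P (map (case_option (r d) id) ts)) \<and>
    finite (r ` domain M) \<and> card (r ` domain M) \<le> k + 2 ^ (Suc q * (Suc q * Suc k ^ q))"
proof -
  define A where "A = insert None (Some ` K)"
  define X where "X = {..q} \<times> {ts. set ts \<subseteq> A \<and> length ts \<le> q}"
  have A: "finite A" "card A \<le> Suc k"
    using assms by (auto simp: A_def card_insert_if card_image)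
  have finX: "finite X" using finite_lists_length_le[OF A(1)] by (simp add: X_def)
  have "card {ts. set ts \<subseteq> A \<and> length ts \<le> q} = (\<Sum>i\<le>q. card A ^ i)"
    by (rule card_lists_length_le[OF A(1)])
  also have "\<dots> \<le> (\<Sum>i\<le>q. Suc k ^ q)"
  proof (rule sum_mono)
    fix i assume "i \<in> {..q}"
    then have "card A ^ i \<le> Suc k ^ i" "Suc k ^ i \<le> Suc k ^ q"
      using A(2) by (simp_all add: power_mono power_increasing del: power_Suc)
    then show "card A ^ i \<le> Suc k ^ q" by simp
  qed
  finally have "card {ts. set ts \<subseteq> A \<and> length ts \<le> q} \<le> Suc q * Suc k ^ q" by simp
  then have cX: "card X \<le> Suc q * (Suc q * Suc k ^ q)"
    unfolding X_def card_cartesian_product card_atMost by (rule mult_le_mono2)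
  define type where "type d = {(P, ts) \<in> X. prd M P (map (case_option d id) ts)}" for d
  define h where "h T = (SOME d. d \<in> domain M - K \<and> type d = T)" for T
  have h: "h (type d) \<in> domain M - K \<and> type (h (type d)) = type d" if "d \<in> domain M - K" for d
    unfolding h_def by (rule someI[of _ d]) (use that in auto)
  define r where "r d = (if d \<in> K then d else h (type d))" for d
  have sub: "r ` domain M \<subseteq> K \<union> h ` Pow X" by (auto simp: r_def type_def)
  have fin: "finite (K \<union> h ` Pow X)" using assms finX by simp
  have "card (r ` domain M) \<le> card (K \<union> h ` Pow X)" by (rule card_mono[OF fin sub])
  also have "\<dots> \<le> card K + card (h ` Pow X)" by (rule card_Un_le)
  also have "card (h ` Pow X) \<le> 2 ^ card X"
    using card_image_le[of "Pow X" h] finX by (simp add: card_Pow)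
  also have "(2::nat) ^ card X \<le> 2 ^ (Suc q * (Suc q * Suc k ^ q))"
    by (rule power_increasing[OF cX]) simp
  finally have card: "card (r ` domain M) \<le> k + 2 ^ (Suc q * (Suc q * Suc k ^ q))"
    using assms(3) by simp
  have "prd M P (map (case_option d id) ts) = prd M P (map (case_option (r d) id) ts)"
    if "d \<in> domain M - K" "P \<le> q" "length ts \<le> q" "set ts \<subseteq> insert None (Some ` K)" for d P ts
  proof -
    have "(P, ts) \<in> X" using that by (simp add: X_def A_def)
    moreover have "(P, ts) \<in> type d \<longleftrightarrow> (P, ts) \<in> type (r d)" using that(1) h by (simp add: r_def)
    ultimately show ?thesis by (simp add: type_def)
  qed
  moreover have "\<forall>d\<in>K. r d = d" "\<forall>d\<in>domain M - K. r d \<in> domain M - K"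
    using h by (auto simp: r_def)
  ultimately show ?thesis
    using card finite_subset[OF sub fin] by (intro exI[of _ r] conjI) blast+
qed

section \<open>The prefix as a list sorted by block index\<close>

lemma in_block_unique:
  assumes "distinct (concat xss)" "i < length xss" "j < length xss"
    "v \<in> set (xss ! i)" "v \<in> set (xss ! j)"
  shows "i = j"
proof -
  have False if "i < j" "j < length xss" "v \<in> set (xss ! i)" "v \<in> set (xss ! j)" for i j
  proof -
    have "distinct (concat (take j xss @ xss ! j # drop (Suc j) xss))"
      using assms(1) id_take_nth_drop[OF that(2)] by simp
    moreover have "xss ! i \<in> set (take j xss)"
      using that(1,2) by (auto simp: in_set_conv_nth intro!: exI[of _ i])
    ultimately show False using that(3,4) by auto
  qed
  then show ?thesis using assms by (metis linorder_neqE_nat)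
qed

lemma idx_eq:
  assumes "distinct (concat (map (\<lambda>(xs, ys). xs @ ys) bs))" "k < length bs"
    "v \<in> set (fst (bs ! k)) \<union> set (snd (bs ! k))"
  shows "idx bs v = k"
  unfolding idx_def
proof (rule the_equality)
  fix l assume l: "l < length bs \<and> (v \<in> set (fst (bs ! l)) \<or> v \<in> set (snd (bs ! l)))"
  show "l = k"
    by (rule in_block_unique[OF assms(1), of _ _ v])
      (use l assms in \<open>auto simp: case_prod_unfold\<close>)
qed (use assms in auto)

lemma set_linear: "set (linear bs) = Pair True ` univ_vars bs \<union> Pair False ` ex_vars bs"
  by (auto simp: linear_def univ_vars_def ex_vars_def)

lemma map_snd_linear: "map snd (linear bs) = concat (map (\<lambda>(xs, ys). xs @ ys) bs)"
  by (induction bs) (auto simp: linear_def comp_def)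

lemma in_linear_block:
  "(b, v) \<in> set (linear bs) \<Longrightarrow> \<exists>k<length bs. v \<in> set (fst (bs ! k)) \<union> set (snd (bs ! k))"
  unfolding linear_def by (fastforce simp: in_set_conv_nth[of _ bs])

text \<open>Within a block the universal quantifiers come first, so a universal variable after an
  existential one belongs to a later block: hence the strict inequality. The offset \<open>c\<close>
  serves the induction, where dropping the first block renumbers the others.\<close>

lemma sorted_linear:
  assumes "\<And>k v. k < length bs \<Longrightarrow> v \<in> set (fst (bs ! k)) \<union> set (snd (bs ! k)) \<Longrightarrow> f v = c + k"
  shows "sorted_wrt (\<lambda>(b, v) (b', w). f v \<le> f w \<and> (\<not> b \<and> b' \<longrightarrow> f v < (f w :: nat))) (linear bs)"
  using assms
proof (induction bs arbitrary: c)
  case Nil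
  then show ?case by (simp add: linear_def)
next
  case (Cons xy bs)
  obtain xs ys where xy: "xy = (xs, ys)" by force
  have first: "f v = c" if "v \<in> set xs \<union> set ys" for v
    using Cons.prems[of 0 v] that xy by simp
  have later: "f v = Suc c + k"
    if "k < length bs" "v \<in> set (fst (bs ! k)) \<union> set (snd (bs ! k))" for k v
    using Cons.prems[of "Suc k" v] that by simp
  then have rest: "c < f v" if "(b, v) \<in> set (linear bs)" for b v
    using in_linear_block[OF that] by fastforce
  have "linear (xy # bs) = map (Pair True) xs @ map (Pair False) ys @ linear bs"
    by (simp add: linear_def xy)
  moreover have "sorted_wrt (\<lambda>v w. f v \<le> f w) xs" "sorted_wrt (\<lambda>v w. f v \<le> f w) ys"
    using first by (auto intro!: sorted_wrt_iff_nth_less[THEN iffD2])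
  ultimately show ?case
    using Cons.IH[OF later] first rest by (auto simp: sorted_wrt_append sorted_wrt_map)
      (fastforce dest: rest first)+
qed

text \<open>\<open>k\<close> bounds \<open>K\<close>: the values from
  \<open>finitely_many_globals\<close> with \<open>S = tower q q\<close>, and the values of the
  constants up to \<open>q\<close>. \<open>n\<close> bounds the representatives, the elements of
  \<open>K\<close> and one per type. \<open>Suc n ^ q\<close> bounds the witnesses, and 3 is the
  number of levels.\<close>

definition model_bound :: "nat \<Rightarrow> nat" where
  "model_bound q =
     (let k = Suc (tower q q) ^ q + Suc q; n = k + 2 ^ (Suc q * (Suc q * Suc k ^ q))
      in k + 3 * (n * Suc n ^ q))"

lemma cmp_model_bound: "cmp (\<lambda>r. model_bound (r 0))"
  unfolding model_bound_def tower_def Let_def by (intro cmp_rec computable)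

text \<open>An existential variable becomes local when it occurs in \<open>Atx x\<close> for some
  \<open>x\<close> in the same or an earlier block; all others, including those in no
  \<open>Atx x\<close>, become global.\<close>

lemma gaf_ordered:
  assumes std: "standard_form p bs m" and part: "gaf_partition bs (atoms p) At0 Atx"
  shows "\<exists>own. ackermann_partition (univ_vars bs) At0 Atx own (fm_encode p) \<and>
    ackermann_partition.ordered (univ_vars bs) Atx own {} (linear bs)"
proof -
  let ?U = "univ_vars bs" and ?E = "ex_vars bs" and ?i = "idx bs"
  have dist: "distinct (map snd (linear bs))"
    using std by (simp add: standard_form_def map_snd_linear)
  have atoms: "atoms p = atoms m"
    using std by (auto simp: standard_form_def close_eq_quantify atoms_quantify)
  have disj: "v \<notin> ?E" if "v \<in> ?U" for v
  proof
    assume "v \<in> ?E"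
    then have "(True, v) \<in> set (linear bs)" "(False, v) \<in> set (linear bs)"
      using that by (auto simp: set_linear)
    then show False using dist by (force simp: distinct_map inj_on_def)
  qed
  have At: "atoms p = At0 \<union> (\<Union>x\<in>?U. Atx x)" and At0: "vars At0 \<inter> ?U = {}"
    and Atx: "\<And>x. x \<in> ?U \<Longrightarrow> vars (Atx x) \<inter> ?U = {x}"
    using part by (auto simp: gaf_partition_def)
  have E: "v \<in> ?E" if "x \<in> ?U" "v \<in> vars (Atx x)" "v \<notin> ?U" for x v
  proof -
    have "v \<in> vars (atoms m)" using that At atoms by (auto simp: vars_def)
    then show ?thesis using std that(3) by (auto simp: standard_form_def)
  qed
  \<comment> \<open>Here (c.1) fails because of \<open>x\<close>, so (c.2) holds, and the unique
    universal variable it speaks of must be \<open>x\<close>.\<close>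
  have c2: "\<not> y \<in> vars At0 \<and> (\<forall>x'\<in>?U. y \<in> vars (Atx x') \<longrightarrow> x' = x)"
    if "y \<in> ?E" "x \<in> ?U" "y \<in> vars (Atx x)" "?i x \<le> ?i y" for x y
  proof -
    have "\<not> (\<forall>x\<in>?U. y \<in> vars (Atx x) \<longrightarrow> ?i y < ?i x)" using that by (auto simp: not_less)
    then have "\<exists>x\<in>?U. y \<in> vars (Atx x) \<and> (\<forall>x'\<in>?U. y \<in> vars (Atx x') \<longrightarrow> x' = x) \<and>
        y \<notin> vars At0 \<and> ?i y \<ge> ?i x"
      using part that unfolding gaf_partition_def Let_def by blast
    then show ?thesis using that by blast
  qed
  define own where "own y = (if y \<in> ?E \<and> (\<exists>x\<in>?U. y \<in> vars (Atx x) \<and> ?i x \<le> ?i y)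
    then Some (SOME x. x \<in> ?U \<and> y \<in> vars (Atx x) \<and> ?i x \<le> ?i y) else None)" for y
  have own: "y \<in> ?E \<and> x \<in> ?U \<and> y \<in> vars (Atx x) \<and> ?i x \<le> ?i y" if "own y = Some x" for x y
  proof -
    have "y \<in> ?E" and ex: "\<exists>x. x \<in> ?U \<and> y \<in> vars (Atx x) \<and> ?i x \<le> ?i y"
      and x: "x = (SOME x. x \<in> ?U \<and> y \<in> vars (Atx x) \<and> ?i x \<le> ?i y)"
      using that by (auto simp: own_def split: if_splits)
    then show ?thesis using someI_ex[OF ex] by simp
  qed
  have own_None: "?i y < ?i x" if "own y = None" "y \<in> ?E" "x \<in> ?U" "y \<in> vars (Atx x)" for x y
    using that by (auto simp: own_def not_le split: if_splits)
  interpret ackermann_partition ?U At0 Atx own "fm_encode p"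
  proof
    show "x \<in> ?U \<and> y \<notin> ?U \<and> y \<notin> vars At0" if "own y = Some x" for x y
      using own[OF that] disj c2 by blast
    show "x' = x" if "own y = Some x" "x' \<in> ?U" "y \<in> vars (Atx x')" for x x' y
      using own[OF that(1)] c2 that by blast
    show "atom_encode a \<le> fm_encode p" if "a \<in> At0 \<or> (\<exists>x\<in>?U. a \<in> Atx x)" for a
      by (rule atom_encode_le) (use At that in auto)
  qed (use At0 Atx in auto)
  have sorted: "sorted_wrt (\<lambda>(b, v) (b', w). ?i v \<le> ?i w \<and> (\<not> b \<and> b' \<longrightarrow> ?i v < ?i w)) (linear bs)"
    by (rule sorted_linear[where c = 0])
      (use std in \<open>auto simp: standard_form_def intro!: idx_eq\<close>)
  have "ordered (snd ` set pre) suf" if "linear bs = pre @ suf" for pre suf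
    using that
  proof (induction suf arbitrary: pre)
    case Nil
    then show ?case by simp
  next
    case (Cons bv qs)
    obtain b v where bv: "bv = (b, v)" by force
    have mem: "w \<in> set (linear bs) \<longleftrightarrow> w \<in> set pre \<or> w = (b, v) \<or> w \<in> set qs" for w
      using Cons.prems bv by auto
    have vV: "v \<notin> snd ` set pre" using dist Cons.prems bv by auto
    have IH: "ordered (insert v (snd ` set pre)) qs"
      using Cons.IH[of "pre @ [bv]"] Cons.prems bv by simp
    have pre: "?i w \<le> ?i v \<and> (\<not> c \<and> b \<longrightarrow> ?i w < ?i v)" if "(c, w) \<in> set pre" for c w
      using sorted that bv unfolding Cons.prems by (auto simp: sorted_wrt_append)
    have post: "?i v \<le> ?i w \<and> (\<not> b \<and> c \<longrightarrow> ?i v < ?i w)" if "(c, w) \<in> set qs" for c w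
      using sorted that bv unfolding Cons.prems by (auto simp: sorted_wrt_append)
    show ?case
    proof (cases b)
      case True
      then have vU: "v \<in> ?U" using mem[of "(b, v)"] by (auto simp: set_linear)
      have "case own u of None \<Rightarrow> u \<in> snd ` set pre | Some x' \<Rightarrow> (False, u) \<in> set qs"
        if u: "u \<in> vars (Atx v)" "u \<notin> ?U" for u
      proof -
        have uE: "u \<in> ?E" using E[OF vU u] .
        then have "(False, u) \<in> set (linear bs)" by (simp add: set_linear)
        then have cases: "(False, u) \<in> set pre \<or> (False, u) \<in> set qs" using mem True by auto
        show ?thesis
        proof (cases "own u")
          case None
          have "?i u < ?i v" by (rule own_None[OF None uE vU u(1)])
          then have "(False, u) \<in> set pre" using cases post by fastforce
          then show ?thesis using None by force
        next
          case (Some x)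
          then have "x = v" using own_unique[OF Some vU u(1)] by simp
          then have "?i v \<le> ?i u" using own[OF Some] by simp
          \<comment> \<open>An existential variable before the universal \<open>v\<close> would have
            a strictly smaller index, so \<open>u\<close> comes after \<open>v\<close>.\<close>
          then show ?thesis using Some cases pre[of False u] True by auto
        qed
      qed
      then show ?thesis using bv True vU vV IH by simp
    next
      case False
      then have vE: "v \<in> ?E" using mem[of "(b, v)"] by (auto simp: set_linear)
      have "case own v of None \<Rightarrow> \<forall>x\<in>snd ` set pre \<inter> ?U. v \<notin> vars (Atx x)
        | Some x \<Rightarrow> x \<in> snd ` set pre"
      proof (cases "own v")
        case None
        have "v \<notin> vars (Atx x)" if x: "x \<in> snd ` set pre" "x \<in> ?U" for x
        proof
          assume "v \<in> vars (Atx x)"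
          then have "?i v < ?i x" by (rule own_None[OF None vE x(2)])
          then show False using x(1) pre by fastforce
        qed
        then show ?thesis using None by simp
      next
        case (Some x)
        then have "(True, x) \<in> set (linear bs)" using own by (auto simp: set_linear)
        \<comment> \<open>A universal variable after the existential \<open>v\<close> would have a
          strictly larger index.\<close>
        moreover have "(True, x) \<notin> set qs" using post[of True x] own[OF Some] False by auto
        ultimately have "(True, x) \<in> set pre" using mem False by auto
        then show ?thesis using Some by force
      qed
      moreover have "v \<notin> ?U" using vE disj by blast
      ultimately show ?thesis using bv False vV IH by simp
    qed
  qed
  from this[of "[]"] have "ordered {} (linear bs)" by simp
  then show ?thesis using ackermann_partition_axioms by blast
qed

lemma gaf_small_model:
  assumes "gaf p" "satisfiable p"
  shows "\<exists>N :: (nat + nat \<times> nat \<times> nat) struct.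
    is_struct N \<and> finite (domain N) \<and> card (domain N) \<le> model_bound (fm_encode p) \<and> models N p"
proof -
  obtain bs m At0 Atx where std: "standard_form p bs m"
    and part: "gaf_partition bs (atoms p) At0 Atx" using assms(1) by (auto simp: gaf_def)
  obtain M :: "nat struct" where M: "is_struct M" and mod: "models M p"
    using assms(2) by (auto simp: satisfiable_def)
  define U where "U = univ_vars bs"
  define qs where "qs = linear bs"
  define q where "q = fm_encode p"
  obtain own where partition: "ackermann_partition U At0 Atx own q"
    and ord: "ackermann_partition.ordered U Atx own {} qs"
    using gaf_ordered[OF std part] unfolding U_def qs_def q_def by blast
  interpret ackermann_partition U At0 Atx own q by (rule partition)
  have p: "p = quantify qs m" and qf: "qfree m"
    using std by (auto simp: standard_form_def close_eq_quantify qs_def)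
  have at: "atoms m = At0 \<union> (\<Union>x\<in>U. Atx x)"
    using part by (simp add: gaf_partition_def U_def p atoms_quantify)
  have vars_qs: "snd ` set qs = univ_vars bs \<union> ex_vars bs"
    unfolding qs_def set_linear by (simp add: image_Un image_image)
  then have U_qs: "U \<subseteq> {} \<union> snd ` set qs"
    and at_qs: "vars (At0 \<union> (\<Union>x\<in>U. Atx x)) \<subseteq> {} \<union> snd ` set qs"
    using std unfolding at[symmetric] by (auto simp: U_def standard_form_def)
  have len: "length qs \<le> q" using length_le_encode_quantify[of qs m] p by (simp add: q_def)
  have qsU: "b \<longleftrightarrow> v \<in> U" if "(b, v) \<in> set qs" for b v by (rule ordered_iff[OF ord that])
  define W where "W e = holds M e m" for e
  define S where "S = tower q q"
  define k where "k = Suc S ^ q + Suc q"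
  define n where "n = k + 2 ^ (Suc q * (Suc q * Suc k ^ q))"
  have cM: "cst M c \<in> domain M" for c using M by (auto simp: is_struct_def)
  define e0 :: "nat \<Rightarrow> nat" where "e0 = (\<lambda>_. cst M 0)"
  have "game (\<lambda>_. domain M) W qs e0"
    using mod cM unfolding models_def p holds_quantify W_def by (auto simp: e0_def)
  moreover have "W e'" if sim: "similar M ({} \<union> snd ` set qs) [] e e'" and "W e" for e e'
  proof -
    have "holds M e m = holds M e' m"
      by (rule holds_qfree_cong[OF qf]) (use similar_atoms[OF sim U_qs at_qs] at in auto)
    then show ?thesis using \<open>W e\<close> by (simp add: W_def)
  qed
  moreover have "tower q (length qs) \<le> S" unfolding S_def by (rule tower_mono[OF len])
  moreover have "S > 0" unfolding S_def by (cases q) (simp_all add: tower_simps)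
  ultimately obtain K0 where K0: "finite K0" "K0 \<subseteq> domain M" "card K0 \<le> Suc S ^ length qs"
    "\<And>e'. similar M {} qs e0 e' \<Longrightarrow> game (global_dom M K0) W qs e'"
    using finitely_many_globals[OF ord, of M W e0 S] by blast
  \<comment> \<open>The constants up to \<open>q\<close> join \<open>K\<close>, so that their copies
    do not depend on the centre of a placement.\<close>
  define K where "K = K0 \<union> cst M ` {..q}"
  have K: "finite K" "K \<subseteq> domain M" using K0 cM by (auto simp: K_def)
  have cK: "card K \<le> k"
  proof -
    have "card K \<le> card K0 + card (cst M ` {..q})" unfolding K_def by (rule card_Un_le)
    moreover have "card (cst M ` {..q}) \<le> Suc q"
      using card_image_le[of "{..q}" "cst M"] by simp
    moreover have "Suc S ^ length qs \<le> Suc S ^ q" by (rule power_increasing[OF len]) simp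
    ultimately show ?thesis using K0(3) unfolding k_def by linarith
  qed
  obtain r where r: "\<And>d. d \<in> K \<Longrightarrow> r d = d" "\<And>d. d \<in> domain M - K \<Longrightarrow> r d \<in> domain M - K"
    "\<And>d P ts. d \<in> domain M - K \<Longrightarrow> P \<le> q \<and> length ts \<le> q \<and> set ts \<subseteq> insert None (Some ` K) \<Longrightarrow>
       prd M P (map (case_option d id) ts) = prd M P (map (case_option (r d) id) ts)"
    "finite (r ` domain M)" "card (r ` domain M) \<le> n"
    using type_representatives[OF K cK, of q] unfolding n_def by blast
  define R where "R = r ` domain M"
  have RM: "R \<subseteq> domain M" using r(1,2) K by (fastforce simp: R_def)
  \<comment> \<open>Confining universal moves to representatives can only help the existential
    player and makes the branching finite, as \<open>finitely_many_witnesses\<close>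
    requires.\<close>
  define D where "D v = (if v \<in> U then R else if own v = None then K else domain M)" for v
  have "game (global_dom M K0) W qs e0" by (rule K0(4)) (simp add: similar_def)
  then have "game D W qs e0"
    by (rule game_mono) (use qsU RM in \<open>auto simp: D_def global_dom_def K_def\<close>)
  moreover have "n > 0" by (simp add: n_def)
  moreover have "finite (D v) \<and> card (D v) \<le> n" if "v \<in> U" for v
    using that r(4,5) by (simp add: D_def R_def)
  moreover have "D v \<subseteq> domain M" if "v \<notin> U" for v using that K by (simp add: D_def)
  ultimately obtain F where wit: "finite F" "F \<subseteq> domain M" "card F \<le> Suc n ^ length qs"
    "game (\<lambda>v. if v \<in> U then D v else D v \<inter> F) W qs e0"
    using finitely_many_witnesses[of D W qs e0 U n "domain M"] qsU by blast
  interpret ackermann_copy U At0 Atx own M K R F r q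
  proof
    show "cst M c \<in> K" if "c \<le> q" for c using that by (simp add: K_def)
    show "R = r ` domain M" "finite R" using r(4) by (simp_all add: R_def)
    show "r d = d" if "d \<in> K" for d by (rule r(1)[OF that])
    show "r d \<in> domain M - K" if "d \<in> domain M" "d \<notin> K" for d using r(2) that by blast
    show "prd M P (map (case_option d id) ts) = prd M P (map (case_option (r d) id) ts)"
      if "d \<in> domain M" "d \<notin> K" "P \<le> q" "length ts \<le> q" "set ts \<subseteq> insert None (Some ` K)"
      for d P ts using r(3)[of d P ts] that by blast
  qed (fact K wit)+
  have D: "(\<lambda>v. if v \<in> U then D v else D v \<inter> F) =
      (\<lambda>v. if v \<in> U then R else if own v = None then K \<inter> F else F)"
    by (rule HOL.ext) (use wit(2) in \<open>auto simp: D_def\<close>)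
  have "models copy p"
    unfolding models_def p holds_quantify
  proof (intro allI impI)
    \<comment> \<open>Before any variable is chosen \<open>matched\<close> is vacuous, so the
      initial assignment of the copy may be arbitrary.\<close>
    fix e' :: "nat \<Rightarrow> nat elem"
    show "game (\<lambda>_. domain copy) (\<lambda>e. holds copy e m) qs e'"
    proof (rule game_copy[OF ord _ wit(4)[unfolded D]])
      show "holds copy e' m" if match: "matched ({} \<union> snd ` set qs) e e'" and "W e" for e e'
      proof -
        have "holds copy e' m = holds M e m"
          by (rule holds_qfree_cong[OF qf]) (use matched_atoms[OF match U_qs at_qs] at in auto)
        then show ?thesis using \<open>W e\<close> by (simp add: W_def)
      qed
    qed (simp add: matched_def)
  qed
  moreover have "card (domain copy) \<le> model_bound q"
  proof -
    have "card F \<le> Suc n ^ q"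
      using wit(3) power_increasing[OF len, of "Suc n"] by simp
    then have "card R * card F \<le> n * Suc n ^ q"
      using r(5) unfolding R_def by (rule mult_le_mono[rotated])
    then show ?thesis
      using card_copy cK by (simp add: model_bound_def Let_def S_def k_def n_def)
  qed
  ultimately show ?thesis using is_struct_copy finite_copy unfolding q_def by blast
qed

theorem theorem6: "decidable_for gaf satisfiable"
proof -
  obtain f where f: "recursive 1 f"
    "\<And>q. f [q] = (if \<exists>n<Suc (model_bound q). has_model_table q n then 1 else 0)"
    using decidable_bounded_model_search[OF cmp_model_bound] by blast
  \<comment> \<open>A table of any size yields a model; membership in the fragment enters through
    the bound on the size.\<close>
  have "(\<exists>n<Suc (model_bound (fm_encode p)). has_model_table (fm_encode p) n) \<longleftrightarrow> satisfiable p"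
    if "gaf p" for p
    using gaf_small_model[OF that] finite_model_imp_has_model_table[of _ p]
      has_model_table_imp_satisfiable[of p] by (meson le_imp_less_Suc)
  then show ?thesis unfolding decidable_for_def using f by auto
qed

end
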